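(* For any family of finite Markov Decision Processes indexed by the number $n$ of states and the total number $m$ of actions (with discount factors in $(0,1)$) such that the structural constants $\tau_t$ and $\tau_r$ (defined in the context) are polynomial functions of $n$ and $m$, Simplex-PI terminates after a number of iterations that is polynomial in $n$ and $m$.
   Context: A finite Markov Decision Process (MDP) consists of a state space $X=\{1,\dots,n\}$; a finite action space $A$ of size $m$, partitioned into nonempty sets $A_i$ ($i\in X$), where $A_i$ is the set of admissible actions in state $i$; transition probabilities $p_{ij}(a)=\mathbb{P}(i_{t+1}=j\mid i_t=i,a_t=a)$ for $a\in A_i$; a reward function $r(i,a,j)\in\mathbb{R}$; and a discount factor $\gamma\in(0,1)$. A policy is a map $\pi:X\to A$ with $\pi(i)\in A_i$ for all $i$. Let $P_\pi$ be the $n\times n$ stochastic matrix with entries $p_{ij}(\pi(i))$ and $r_\pi$ the vector with components $\sum_j p_{ij}(\pi(i))r(i,\pi(i),j)$. The operator $T_\pi$ is $T_\pi v=r_\pi+\gamma P_\pi v$, and the value $v_\pi\in\mathbb{R}^n$ of $\pi$ is its unique fixed point. The optimal value is $v_*=\max_\pi v_\pi$ (componentwise); a policy is optimal if its value is $v_*$. Let $Tv=\max_\pi T_\pi v$ (componentwise); a policy $\pi$ is greedy with respect to $v$ if $T_\pi v=Tv$, and $\mathcal{G}(v)$ denotes any such policy. The maximal advantage with respect to $\pi$ is $a_\pi=Tv_\pi-v_\pi\ge 0$, and $S_\pi=\{i: a_\pi(i)>0\}$; $\pi$ is optimal iff $S_\pi=\emptyset$. For nonempty $Y\subseteq S_\pi$,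 $\mathrm{switch}(\pi,Y)$ is the policy equal to $\mathcal{G}(v_\pi)(i)$ for $i\in Y$ and to $\pi(i)$ for $i\notin Y$. Simplex-PI generates, from an initial policy $\pi_0$, the sequence $\pi_{k+1}=\mathrm{switch}(\pi_k,\{i_k\})$ where $i_k\in\arg\max_i a_{\pi_k}(i)$. It terminates when $\pi_k$ is optimal; one iteration is one update $\pi_k\to\pi_{k+1}$. Structural constants: for a policy $\pi$, state $i$ and time $t$, let $\tau^\pi(i,t)=\sum_{k=0}^{t-1}\mathbb{P}(i_k=i\mid i_0\sim U,\ a_k=\pi(i_k))$, where $U$ is the uniform distribution on $X$, and let $\mu^\pi(i)=\lim_{t\to\infty}\frac1t\tau^\pi(i,t)$. A state is transient (resp. recurrent) for $\pi$ if it is so for the Markov chain $P_\pi$. The constants $\tau_t$ and $\tau_r$ are the smallest finite constants such that for all policies $\pi$ and states $i$: if $i$ is transient for $\pi$ then $\lim_{t\to\infty}\tau^\pi(i,t)\le\tau_t$; if $i$ is recurrent for $\pi$ then $\frac{1}{\mu^\pi(i)}\le\tau_r$. *)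

theory Defs
  imports Complex_Main "HOL-Library.FuncSet" "HOL-Library.Disjoint_Sets"
    "HOL-Computational_Algebra.Polynomial" "Jordan_Normal_Form.Matrix"
begin

text \<open>
  The states of an MDP are \<open>0, \<dots>, nstates M - 1\<close>, and \<open>trans M i a j\<close>
  is the probability of moving from \<open>i\<close> to \<open>j\<close> under action \<open>a\<close>. The
  fields are only meaningful for \<open>i, j < nstates M\<close> and \<open>a \<in> admissible M i\<close>.
\<close>

record 'a mdp =
  nstates :: nat
  actions :: "'a set"
  admissible :: "nat \<Rightarrow> 'a set"
  trans :: "nat \<Rightarrow> 'a \<Rightarrow> nat \<Rightarrow> real"
  reward :: "nat \<Rightarrow> 'a \<Rightarrow> nat \<Rightarrow> real"
  discount :: real

definition finite_mdp :: "'a mdp \<Rightarrow> bool" where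
  "finite_mdp M \<longleftrightarrow>
     0 < nstates M \<and>
     finite (actions M) \<and>
     (\<Union>i<nstates M. admissible M i) = actions M \<and>
     disjoint_family_on (admissible M) {..<nstates M} \<and>
     (\<forall>i<nstates M. admissible M i \<noteq> {}) \<and>
     (\<forall>i<nstates M. \<forall>a\<in>admissible M i.
        (\<forall>j<nstates M. 0 \<le> trans M i a j) \<and> (\<Sum>j<nstates M. trans M i a j) = 1) \<and>
     0 < discount M \<and> discount M < 1"

definition policies :: "'a mdp \<Rightarrow> (nat \<Rightarrow> 'a) set" where
  "policies M = (\<Pi>\<^sub>E i\<in>{..<nstates M}. admissible M i)"

definition P_mat :: "'a mdp \<Rightarrow> (nat \<Rightarrow> 'a) \<Rightarrow> real mat" where
  "P_mat M \<pi> = mat (nstates M) (nstates M) (\<lambda>(i, j). trans M i (\<pi> i) j)"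

definition r_vec :: "'a mdp \<Rightarrow> (nat \<Rightarrow> 'a) \<Rightarrow> real vec" where
  "r_vec M \<pi> = vec (nstates M)
     (\<lambda>i. \<Sum>j<nstates M. trans M i (\<pi> i) j * reward M i (\<pi> i) j)"

definition T_pol :: "'a mdp \<Rightarrow> (nat \<Rightarrow> 'a) \<Rightarrow> real vec \<Rightarrow> real vec" where
  "T_pol M \<pi> v = r_vec M \<pi> + discount M \<cdot>\<^sub>v (P_mat M \<pi> *\<^sub>v v)"

definition val :: "'a mdp \<Rightarrow> (nat \<Rightarrow> 'a) \<Rightarrow> real vec" where
  "val M \<pi> = (THE v. v \<in> carrier_vec (nstates M) \<and> T_pol M \<pi> v = v)"

definition opt_val :: "'a mdp \<Rightarrow> real vec" where
  "opt_val M = vec (nstates M) (\<lambda>i. Max ((\<lambda>\<pi>. val M \<pi> $ i) ` policies M))"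

definition optimal :: "'a mdp \<Rightarrow> (nat \<Rightarrow> 'a) \<Rightarrow> bool" where
  "optimal M \<pi> \<longleftrightarrow> \<pi> \<in> policies M \<and> val M \<pi> = opt_val M"

definition T_opt :: "'a mdp \<Rightarrow> real vec \<Rightarrow> real vec" where
  "T_opt M v = vec (nstates M) (\<lambda>i. Max ((\<lambda>\<pi>. T_pol M \<pi> v $ i) ` policies M))"

definition greedy :: "'a mdp \<Rightarrow> real vec \<Rightarrow> (nat \<Rightarrow> 'a) \<Rightarrow> bool" where
  "greedy M v \<pi> \<longleftrightarrow> \<pi> \<in> policies M \<and> T_pol M \<pi> v = T_opt M v"

definition advantage :: "'a mdp \<Rightarrow> (nat \<Rightarrow> 'a) \<Rightarrow> real vec" where
  "advantage M \<pi> = T_opt M (val M \<pi>) - val M \<pi>"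

definition switch :: "(nat \<Rightarrow> 'a) \<Rightarrow> (nat \<Rightarrow> 'a) \<Rightarrow> nat set \<Rightarrow> nat \<Rightarrow> 'a" where
  "switch \<pi> g Y = (\<lambda>i. if i \<in> Y then g i else \<pi> i)"

text \<open>
  Neither the greedy policy nor the state of maximal advantage need be unique, so an
  iteration is a relation: every way of resolving the ties is allowed.
\<close>

definition simplex_pi_step :: "'a mdp \<Rightarrow> (nat \<Rightarrow> 'a) \<Rightarrow> (nat \<Rightarrow> 'a) \<Rightarrow> bool" where
  "simplex_pi_step M \<pi> \<pi>' \<longleftrightarrow>
     (\<exists>g i. greedy M (val M \<pi>) g \<and>
        is_arg_max (\<lambda>i. advantage M \<pi> $ i) (\<lambda>i. i < nstates M) i \<and>
        \<pi>' = switch \<pi> g {i})"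

text \<open>
  A run is recorded as an infinite sequence; the entries after the first optimal
  policy, where the algorithm has stopped, are unconstrained.
\<close>

definition simplex_pi_run :: "'a mdp \<Rightarrow> (nat \<Rightarrow> nat \<Rightarrow> 'a) \<Rightarrow> bool" where
  "simplex_pi_run M \<pi>s \<longleftrightarrow>
     \<pi>s 0 \<in> policies M \<and>
     (\<forall>k. (\<forall>l\<le>k. \<not> optimal M (\<pi>s l)) \<longrightarrow> simplex_pi_step M (\<pi>s k) (\<pi>s (Suc k)))"

text \<open>
  The probability that the first \<open>k\<close> steps of the Markov chain on \<open>{..<n}\<close> with initial
  distribution \<open>d\<close> and transition matrix \<open>P\<close> satisfy \<open>E\<close>: the sum of the probabilities of
  the trajectories \<open>x 0, \<dots>, x k\<close> in \<open>E\<close>.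
\<close>

definition path_prob ::
  "nat \<Rightarrow> real mat \<Rightarrow> (nat \<Rightarrow> real) \<Rightarrow> nat \<Rightarrow> ((nat \<Rightarrow> nat) \<Rightarrow> bool) \<Rightarrow> real" where
  "path_prob n P d k E =
     (\<Sum>x | x \<in> {..k} \<rightarrow>\<^sub>E {..<n} \<and> E x. d (x 0) * (\<Prod>l<k. P $$ (x l, x (Suc l))))"

definition return_prob :: "'a mdp \<Rightarrow> (nat \<Rightarrow> 'a) \<Rightarrow> nat \<Rightarrow> real" where
  "return_prob M \<pi> i =
     lim (\<lambda>k. path_prob (nstates M) (P_mat M \<pi>) (\<lambda>j. if j = i then 1 else 0) k
                (\<lambda>x. \<exists>l\<in>{1..k}. x l = i))"

definition recurrent :: "'a mdp \<Rightarrow> (nat \<Rightarrow> 'a) \<Rightarrow> nat \<Rightarrow> bool" where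
  "recurrent M \<pi> i \<longleftrightarrow> return_prob M \<pi> i = 1"

definition transient :: "'a mdp \<Rightarrow> (nat \<Rightarrow> 'a) \<Rightarrow> nat \<Rightarrow> bool" where
  "transient M \<pi> i \<longleftrightarrow> return_prob M \<pi> i < 1"

definition tau :: "'a mdp \<Rightarrow> (nat \<Rightarrow> 'a) \<Rightarrow> nat \<Rightarrow> nat \<Rightarrow> real" where
  "tau M \<pi> i t =
     (\<Sum>k<t. path_prob (nstates M) (P_mat M \<pi>) (\<lambda>_. 1 / real (nstates M)) k (\<lambda>x. x k = i))"

definition mu :: "'a mdp \<Rightarrow> (nat \<Rightarrow> 'a) \<Rightarrow> nat \<Rightarrow> real" where
  "mu M \<pi> i = lim (\<lambda>t. 1 / real t * tau M \<pi> i t)"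

text \<open>
  If no policy has a transient state, every real number is an admissible bound and there
  is no least one; requiring nonnegativity makes the constant \<open>0\<close> in that case and changes
  nothing otherwise. For \<open>tau_r\<close> this cannot happen, since a finite chain has a
  recurrent state.
\<close>

definition tau_t :: "'a mdp \<Rightarrow> real" where
  "tau_t M = (LEAST c. 0 \<le> c \<and>
     (\<forall>\<pi>\<in>policies M. \<forall>i<nstates M. transient M \<pi> i \<longrightarrow> lim (tau M \<pi> i) \<le> c))"

definition tau_r :: "'a mdp \<Rightarrow> real" where
  "tau_r M = (LEAST c.
     \<forall>\<pi>\<in>policies M. \<forall>i<nstates M. recurrent M \<pi> i \<longrightarrow> 1 / mu M \<pi> i \<le> c)"

definition poly2 :: "real poly poly \<Rightarrow> real \<Rightarrow> real \<Rightarrow> real" where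
  "poly2 p x y = poly (poly p [:y:]) x"

end

theory Submission
  imports Defs "Jordan_Normal_Form.Determinant"
begin

text \<open>
  For a policy \<open>\<pi>\<close> let \<open>x\<^sub>\<pi>(i)\<close> be the discounted number of visits to \<open>i\<close>, summed over all
  starting states, so that the sum of the values of \<open>\<pi>'\<close> exceeds that of \<open>\<pi>\<close> by the sum of
  \<open>x\<^sub>\<pi>\<^sub>'(i)\<close> times the advantage of \<open>\<pi>'(i)\<close> over \<open>\<pi>\<close>. One has \<open>x\<^sub>\<pi>(i) \<le> n \<tau>\<^sub>t\<close> at transient states and
  \<open>(1 - \<gamma>) x\<^sub>\<pi>(i) \<ge> 1 / \<tau>\<^sub>r\<close> at recurrent ones; the latter because the long-run frequency of \<open>i\<close>
  is at most \<open>(1 - \<gamma>) x\<^sub>\<pi>(i)\<close>.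

  A step whose switched state is recurrent for the new policy shrinks the gap to the optimal
  value by the factor \<open>1 - 1 / (n \<tau>\<^sub>r)\<close>. Any other step can only lose recurrent states; while it
  loses none, the values on the recurrent states are frozen and the gap to the value reached at
  the end of the stretch shrinks by the factor \<open>1 - 1 / (n\<^sup>2 \<tau>\<^sub>t)\<close>. In both regimes, polynomially many
  steps make the gap so small that the state-action pair with the largest share of the initial
  gap can no longer be used (in the first regime possibly: no longer be used at a recurrent
  state, the factors \<open>1 - \<gamma>\<close> cancelling), and there are only \<open>m\<close> pairs to eliminate.
\<close>

section \<open>Solvability of linear systems\<close>

text \<open>A trivial kernel makes the determinant of \<open>1 - Q\<close> nonzero, and the adjugate
  divided by the determinant then gives the solution. The statement uses functions and sums, the
  form in which chains are treated below.\<close>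

lemma linear_system_solvable:
  fixes Q :: "nat \<Rightarrow> nat \<Rightarrow> real"
  assumes inj: "\<And>v. (\<And>j. j < n \<Longrightarrow> v j = (\<Sum>l<n. Q j l * v l)) \<Longrightarrow> \<forall>j<n. v j = 0"
  shows "\<exists>w. \<forall>j<n. w j = b j + (\<Sum>l<n. Q j l * w l)"
proof -
  define A where "A = mat n n (\<lambda>(i, j). (if i = j then 1 else 0) - Q i j)"
  have A: "A \<in> carrier_mat n n" by (simp add: A_def)
  have entry: "(A *\<^sub>v v) $ j = v $ j - (\<Sum>l<n. Q j l * v $ l)"
    if "v \<in> carrier_vec n" "j < n" for v j
  proof -
    have "(A *\<^sub>v v) $ j = (\<Sum>l<n. (if j = l then v $ l else 0) - Q j l * v $ l)"
      using that by (auto simp: A_def scalar_prod_def atLeast0LessThan algebra_simps intro!: sum.cong)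
    also have "\<dots> = v $ j - (\<Sum>l<n. Q j l * v $ l)"
      using that by (simp add: sum_subtractf)
    finally show ?thesis .
  qed
  have "det A \<noteq> 0"
  proof
    assume "det A = 0"
    then obtain v where v: "v \<in> carrier_vec n" "v \<noteq> 0\<^sub>v n" "A *\<^sub>v v = 0\<^sub>v n"
      using det_0_iff_vec_prod_zero[OF A] by blast
    have "\<forall>j<n. v $ j = 0"
    proof (rule inj)
      fix j assume "j < n"
      then show "v $ j = (\<Sum>l<n. Q j l * v $ l)"
        using entry[OF v(1) \<open>j < n\<close>] v(3) by simp
    qed
    then have "v = 0\<^sub>v n" using v(1) by (intro eq_vecI) auto
    then show False using v(2) by simp
  qed
  define w where "w = (1 / det A) \<cdot>\<^sub>v (adj_mat A *\<^sub>v vec n b)"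
  have adj: "adj_mat A \<in> carrier_mat n n" "A * adj_mat A = det A \<cdot>\<^sub>m 1\<^sub>m n"
    using adj_mat[OF A] by auto
  have w: "w \<in> carrier_vec n" using adj(1) by (auto simp: w_def intro!: smult_carrier_vec mult_mat_vec_carrier)
  have "A *\<^sub>v w = (1 / det A) \<cdot>\<^sub>v ((A * adj_mat A) *\<^sub>v vec n b)"
    unfolding w_def using A adj(1)
    by (subst mult_mat_vec[OF A]) (auto simp: assoc_mult_mat_vec[OF A adj(1)] intro!: mult_mat_vec_carrier)
  also have "\<dots> = vec n b"
    using \<open>det A \<noteq> 0\<close>
    by (intro eq_vecI) (auto simp: adj(2) row_smult smult_scalar_prod_distrib[of _ n])
  finally have Aw: "A *\<^sub>v w = vec n b" .
  have "\<forall>j<n. w $ j = b j + (\<Sum>l<n. Q j l * w $ l)"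
  proof (intro allI impI)
    fix j assume "j < n"
    then show "w $ j = b j + (\<Sum>l<n. Q j l * w $ l)"
      using entry[OF w \<open>j < n\<close>] by (simp add: Aw)
  qed
  then show ?thesis by blast
qed

section \<open>Evaluation of bivariate polynomials\<close>

lemma poly2_1 [simp]: "poly2 1 x y = 1"
  by (simp add: poly2_def)

lemma poly2_add [simp]: "poly2 (p + q) x y = poly2 p x y + poly2 q x y"
  by (simp add: poly2_def)

lemma poly2_mult [simp]: "poly2 (p * q) x y = poly2 p x y * poly2 q x y"
  by (simp add: poly2_def)

lemma poly2_numeral [simp]: "poly2 (numeral k) x y = numeral k"
  by (simp add: poly2_def)

lemma poly2_power [simp]: "poly2 (p ^ k) x y = poly2 p x y ^ k"
  by (simp add: poly2_def)

text \<open>\<open>poly2\<close> evaluates the outer variable at the second argument and the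
  variable of the coefficients at the first, so the first coordinate is a constant polynomial whose
  coefficient is a monomial.\<close>

lemma poly2_fst [simp]: "poly2 [:[:0, 1:]:] x y = x"
  by (simp add: poly2_def)

lemma poly2_snd [simp]: "poly2 [:0, 1:] x y = y"
  by (simp add: poly2_def)

section \<open>Finite Markov chains\<close>

locale finite_chain =
  fixes n :: nat and P :: "nat \<Rightarrow> nat \<Rightarrow> real"
  assumes P_nonneg: "\<lbrakk>j < n; l < n\<rbrakk> \<Longrightarrow> 0 \<le> P j l"
    and P_sum: "j < n \<Longrightarrow> (\<Sum>l<n. P j l) = 1"
begin

definition app :: "(nat \<Rightarrow> real) \<Rightarrow> nat \<Rightarrow> real" where
  "app v j = (\<Sum>l<n. P j l * v l)"

definition edges :: "(nat \<times> nat) set" where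
  "edges = {(j, l). j < n \<and> l < n \<and> 0 < P j l}"

text \<open>Recurrence in graph terms: the states of closed communicating classes. The link to
  return probabilities is made by \<open>hitlim_rec\<close> and
  \<open>hitlim_not_rec\<close>.\<close>

definition rec :: "nat set" where
  "rec = {i. i < n \<and> (\<forall>k. (i, k) \<in> edges\<^sup>* \<longrightarrow> (k, i) \<in> edges\<^sup>*)}"

lemma app_const [simp]: "j < n \<Longrightarrow> app (\<lambda>_. c) j = c"
  using P_sum by (simp add: app_def flip: sum_distrib_right)

lemma app_add: "app (\<lambda>l. u l + v l) j = app u j + app v j"
  by (simp add: app_def distrib_left sum.distrib)

lemma app_diff: "app (\<lambda>l. u l - v l) j = app u j - app v j"
  by (simp add: app_def right_diff_distrib sum_subtractf)

lemma app_cmult: "app (\<lambda>l. c * v l) j = c * app v j"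
  by (simp add: app_def sum_distrib_left algebra_simps)

lemma app_mono: "\<lbrakk>j < n; \<And>l. l < n \<Longrightarrow> u l \<le> v l\<rbrakk> \<Longrightarrow> app u j \<le> app v j"
  unfolding app_def by (intro sum_mono mult_left_mono P_nonneg) auto

lemma app_cong: "(\<And>l. l < n \<Longrightarrow> u l = v l) \<Longrightarrow> app u j = app v j"
  unfolding app_def by (intro sum.cong) auto

lemma app_sum: "app (\<lambda>l. \<Sum>i\<in>I. v i l) j = (\<Sum>i\<in>I. app (v i) j)"
  unfolding app_def by (simp add: sum_distrib_left sum.swap[of _ I])

text \<open>The nonnegative terms \<open>P j l * (c - f l)\<close> have a sum of at most 0, so each
  of them vanishes. This is the maximum principle in local form.\<close>

lemma app_attains_max:
  assumes "j < n" "l < n" "0 < P j l" "c \<le> app f j"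
    and le: "\<And>l. \<lbrakk>l < n; 0 < P j l\<rbrakk> \<Longrightarrow> f l \<le> c"
  shows "f l = c"
proof -
  have nn: "0 \<le> P j l * (c - f l)" if "l < n" for l
    using P_nonneg[OF \<open>j < n\<close> that] le[OF that] by (cases "P j l = 0") auto
  have "(\<Sum>l<n. P j l * (c - f l)) = c - app f j"
    using P_sum[OF \<open>j < n\<close>] by (simp add: app_def right_diff_distrib sum_subtractf flip: sum_distrib_right)
  then have "(\<Sum>l<n. P j l * (c - f l)) = 0"
    using \<open>c \<le> app f j\<close> sum_nonneg[of "{..<n}" "\<lambda>l. P j l * (c - f l)"] nn by auto
  then have "P j l * (c - f l) = 0"
    using nn \<open>l < n\<close> sum_nonneg_eq_0_iff[of "{..<n}" "\<lambda>l. P j l * (c - f l)"] by auto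
  then show ?thesis using \<open>0 < P j l\<close> by simp
qed

lemma app_attains_min:
  assumes "j < n" "l < n" "0 < P j l" "app f j \<le> c"
    and "\<And>l. \<lbrakk>l < n; 0 < P j l\<rbrakk> \<Longrightarrow> c \<le> f l"
  shows "f l = c"
  using app_attains_max[of j l "-c" "\<lambda>l. - f l"] assms app_cmult[of "-1" f j] by simp

text \<open>Carries a property to all reachable states once the maximum principle shows that
  positive transitions preserve it.\<close>

lemma edges_closed:
  assumes "(j, k) \<in> edges\<^sup>*" "j \<in> Z"
    and "\<And>j l. \<lbrakk>j \<in> Z; j < n; l < n; 0 < P j l\<rbrakk> \<Longrightarrow> l \<in> Z"
  shows "k \<in> Z"
  using assms(1,2) by (induction rule: rtrancl_induct) (auto simp: edges_def intro: assms(3))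

lemma edges_less: "\<lbrakk>(j, k) \<in> edges\<^sup>*; j < n\<rbrakk> \<Longrightarrow> k < n"
  by (erule edges_closed[where Z = "{..<n}", simplified])

lemma ex_successor:
  assumes "j < n" obtains l where "l < n" "0 < P j l"
proof -
  have "\<exists>l<n. P j l > 0"
  proof (rule ccontr)
    assume "\<not> (\<exists>l<n. P j l > 0)"
    then have "(\<Sum>l<n. P j l) \<le> 0" by (intro sum_nonpos) (meson lessThan_iff not_less)
    then show False using P_sum[OF \<open>j < n\<close>] by simp
  qed
  then show ?thesis using that by blast
qed

lemma rec_less: "i \<in> rec \<Longrightarrow> i < n"
  by (simp add: rec_def)

lemma rec_edges:
  assumes "i \<in> rec" "(i, k) \<in> edges\<^sup>*" shows "k \<in> rec"
proof -
  have "(k, i) \<in> edges\<^sup>*" using assms by (auto simp: rec_def)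
  have "(l, k) \<in> edges\<^sup>*" if "(k, l) \<in> edges\<^sup>*" for l
  proof -
    have "(i, l) \<in> edges\<^sup>*" using assms(2) that by (rule rtrancl_trans)
    then have "(l, i) \<in> edges\<^sup>*" using assms(1) by (simp add: rec_def)
    then show ?thesis using assms(2) by (rule rtrancl_trans)
  qed
  then show ?thesis using edges_less[OF assms(2) rec_less[OF assms(1)]] by (simp add: rec_def)
qed

subsection \<open>Hitting probabilities\<close>

text \<open>Probability of visiting \<open>i\<close> at some time in \<open>{1..k}\<close> when
  started in \<open>j\<close>. Time 0 does not count, so \<open>hit i k i\<close> measures
  returns.\<close>

primrec hit :: "nat \<Rightarrow> nat \<Rightarrow> nat \<Rightarrow> real" where
  "hit i 0 = (\<lambda>j. 0)"
| "hit i (Suc k) = app (\<lambda>l. if l = i then 1 else hit i k l)"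

definition hitlim :: "nat \<Rightarrow> nat \<Rightarrow> real" where
  "hitlim i j = lim (\<lambda>k. hit i k j)"

lemma hit_bounds: "j < n \<Longrightarrow> 0 \<le> hit i k j \<and> hit i k j \<le> 1"
proof (induction k arbitrary: j)
  case (Suc k)
  then show ?case
    using app_mono[of j "\<lambda>_. 0" "\<lambda>l. if l = i then 1 else hit i k l"]
          app_mono[of j "\<lambda>l. if l = i then 1 else hit i k l" "\<lambda>_. 1"] by auto
qed simp

lemma hit_mono: "j < n \<Longrightarrow> hit i k j \<le> hit i (Suc k) j"
proof (induction k arbitrary: j)
  case 0
  then show ?case using hit_bounds[of j i 1] by simp
next
  case (Suc k)
  have "app (\<lambda>l. if l = i then 1 else hit i k l) j \<le> app (\<lambda>l. if l = i then 1 else hit i (Suc k) l) j"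
    by (intro app_mono Suc.prems) (use Suc.IH in auto)
  then show ?case by simp
qed

lemma hit_LIMSEQ: assumes "j < n" shows "(\<lambda>k. hit i k j) \<longlonglongrightarrow> hitlim i j"
proof -
  have "incseq (\<lambda>k. hit i k j)" using hit_mono[OF assms] by (intro incseq_SucI)
  then have "convergent (\<lambda>k. hit i k j)"
    using hit_bounds[OF assms] by (metis incseq_convergent convergentI)
  then show ?thesis by (simp add: hitlim_def convergent_LIMSEQ_iff)
qed

lemma hitlim_bounds: assumes "j < n" shows "0 \<le> hitlim i j" "hitlim i j \<le> 1"
  using LIMSEQ_le_const[OF hit_LIMSEQ[OF assms]] LIMSEQ_le_const2[OF hit_LIMSEQ[OF assms]]
    hit_bounds[OF assms] by blast+

lemma hitlim_eq:
  assumes "j < n" shows "hitlim i j = app (\<lambda>l. if l = i then 1 else hitlim i l) j"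
proof -
  have "(\<lambda>k. app (\<lambda>l. if l = i then 1 else hit i k l) j) \<longlonglongrightarrow>
        app (\<lambda>l. if l = i then 1 else hitlim i l) j"
    unfolding app_def by (intro tendsto_sum tendsto_mult tendsto_const) (auto intro: hit_LIMSEQ)
  moreover have "(\<lambda>k. hit i (Suc k) j) \<longlonglongrightarrow> hitlim i j"
    using LIMSEQ_Suc[OF hit_LIMSEQ[OF assms]] .
  ultimately show ?thesis using LIMSEQ_unique by auto
qed

lemma hit_pos_reaches: "\<lbrakk>j < n; i < n; 0 < hit i k j\<rbrakk> \<Longrightarrow> (j, i) \<in> edges\<^sup>+"
proof (induction k arbitrary: j)
  case (Suc k)
  let ?f = "\<lambda>l. if l = i then 1 else hit i k l"
  have "\<exists>l<n. P j l * ?f l \<noteq> 0"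
  proof (rule ccontr)
    assume "\<not> (\<exists>l<n. P j l * ?f l \<noteq> 0)"
    then have "app ?f j = 0" unfolding app_def by (intro sum.neutral) blast
    then show False using Suc.prems by simp
  qed
  then obtain l where l: "l < n" "P j l * ?f l \<noteq> 0" by blast
  then have edge: "(j, l) \<in> edges"
    using Suc.prems P_nonneg[OF \<open>j < n\<close> \<open>l < n\<close>] by (simp add: edges_def less_le)
  show ?case
  proof (cases "l = i")
    case True
    then show ?thesis using edge by (simp add: r_into_trancl)
  next
    case False
    then have "0 < hit i k l" using l hit_bounds[OF \<open>l < n\<close>, of i k] by (simp add: less_le)
    then have "(l, i) \<in> edges\<^sup>+" using Suc.IH l Suc.prems by blast
    then show ?thesis using edge by (rule trancl_into_trancl2[rotated])
  qed
qed simp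

lemma hitlim_pos_reaches:
  assumes "j < n" "i < n" "0 < hitlim i j" shows "(j, i) \<in> edges\<^sup>+"
proof -
  have "\<forall>\<^sub>F k in sequentially. 0 < hit i k j"
    using order_tendstoD(1)[OF hit_LIMSEQ[OF \<open>j < n\<close>] \<open>0 < hitlim i j\<close>] .
  then obtain k where "0 < hit i k j" by (metis eventually_sequentially order_refl)
  then show ?thesis using hit_pos_reaches assms by blast
qed

text \<open>Consider the minimum of \<open>hitlim i\<close> over the closed class of
  \<open>i\<close>. Were it below 1, all successors of a minimizer would be minimizers other than
  \<open>i\<close>, so no path from there could arrive at \<open>i\<close>, contrary to
  recurrence.\<close>

lemma hitlim_rec: assumes "i \<in> rec" shows "hitlim i i = 1"
proof -
  define C where "C = {l. (i, l) \<in> edges\<^sup>*}"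
  have i: "i < n" "i \<in> C" using assms rec_less by (auto simp: C_def)
  have Cn: "C \<subseteq> {..<n}" using edges_less i by (auto simp: C_def)
  then have "finite C" using finite_subset by blast
  define c where "c = Min (hitlim i ` C)"
  have c: "c \<le> hitlim i l" if "l \<in> C" for l
    using that \<open>finite C\<close> by (simp add: c_def)
  have Csucc: "l \<in> C" if "j \<in> C" "j < n" "l < n" "0 < P j l" for j l
    using that unfolding C_def edges_def by (auto intro: rtrancl_into_rtrancl)
  have "c \<in> hitlim i ` C" unfolding c_def using \<open>finite C\<close> i by (intro Min_in) auto
  then obtain j where j: "j \<in> C" "hitlim i j = c" by auto
  have "\<not> c < 1"
  proof
    assume "c < 1"
    \<comment> \<open>The averaged function is 1 at \<open>i\<close>, hence above the minimum
      \<open>c\<close>; a successor of a minimizer therefore differs from \<open>i\<close>.\<close>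
    have succ: "l \<in> C \<and> l \<noteq> i \<and> hitlim i l = c"
      if "j \<in> C" "hitlim i j = c" "l < n" "0 < P j l" for j l
    proof -
      have "j < n" using that Cn by auto
      have "(if l = i then 1 else hitlim i l) = c"
      proof (rule app_attains_min[OF \<open>j < n\<close> that(3,4)])
        show "app (\<lambda>l. if l = i then 1 else hitlim i l) j \<le> c"
          using hitlim_eq[OF \<open>j < n\<close>] that(2) by simp
        show "c \<le> (if l = i then 1 else hitlim i l)" if "l < n" "0 < P j l" for l
          using c[OF Csucc[OF \<open>j \<in> C\<close> \<open>j < n\<close> that]] \<open>c < 1\<close> by simp
      qed
      then show ?thesis using \<open>c < 1\<close> Csucc that \<open>j < n\<close> by (auto split: if_splits)
    qed
    obtain l where "l < n" "0 < P j l" using ex_successor j Cn by blast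
    then have l: "l \<in> C" "l \<noteq> i" "hitlim i l = c" using succ[OF j] by blast+
    then have "(l, i) \<in> edges\<^sup>*" using assms by (simp add: C_def rec_def)
    then have "i \<in> {z \<in> C. z \<noteq> i \<and> hitlim i z = c}"
    proof (rule edges_closed)
      show "l \<in> {z \<in> C. z \<noteq> i \<and> hitlim i z = c}" using l by simp
      show "l \<in> {z \<in> C. z \<noteq> i \<and> hitlim i z = c}"
        if "j \<in> {z \<in> C. z \<noteq> i \<and> hitlim i z = c}" "j < n" "l < n" "0 < P j l" for j l
        using succ[of j l] that by simp
    qed
    then show False by simp
  qed
  then show ?thesis using c[OF i(2)] hitlim_bounds(2)[OF i(1), of i] by linarith
qed

text \<open>A return probability of 1 would spread, by the maximum principle, to every state
  reachable from \<open>i\<close>, including one from which \<open>i\<close> cannot be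
  reached.\<close>

lemma hitlim_not_rec: assumes "i < n" "i \<notin> rec" shows "hitlim i i < 1"
proof (rule ccontr)
  assume "\<not> hitlim i i < 1"
  then have i: "hitlim i i = 1" using hitlim_bounds[OF \<open>i < n\<close>, of i] by simp
  obtain k where k: "(i, k) \<in> edges\<^sup>*" "(k, i) \<notin> edges\<^sup>*" using assms by (auto simp: rec_def)
  have "k < n" using edges_less k assms by blast
  have "k \<in> {j. hitlim i j = 1}"
  proof (rule edges_closed[OF k(1)])
    fix j l assume *: "j \<in> {j. hitlim i j = 1}" "j < n" "l < n" "0 < P j l"
    have "(if l = i then 1 else hitlim i l) = 1"
      by (rule app_attains_max[OF *(2-4)]) (use * hitlim_eq hitlim_bounds in auto)
    then show "l \<in> {j. hitlim i j = 1}" using i by (auto split: if_splits)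
  qed (use i in simp)
  then have "(k, i) \<in> edges\<^sup>+" using hitlim_pos_reaches[OF \<open>k < n\<close> \<open>i < n\<close>] by simp
  then show False using k(2) by (simp add: trancl_into_rtrancl)
qed

subsection \<open>Visits and Cesaro limits\<close>

text \<open>Expected number of visits to \<open>i\<close> from \<open>j\<close> at the
  \<open>t\<close> times before \<open>t\<close>, the start included.\<close>

primrec visits :: "nat \<Rightarrow> nat \<Rightarrow> nat \<Rightarrow> real" where
  "visits i 0 = (\<lambda>j. 0)"
| "visits i (Suc t) = (\<lambda>j. (if j = i then 1 else 0) + app (visits i t) j)"

lemma visits_nonneg: "j < n \<Longrightarrow> 0 \<le> visits i t j"
proof (induction t arbitrary: j)
  case (Suc t)
  then show ?case using app_mono[of j "\<lambda>_. 0" "visits i t"] by auto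
qed simp

lemma visits_mono: "j < n \<Longrightarrow> visits i t j \<le> visits i (Suc t) j"
proof (induction t arbitrary: j)
  case 0
  then show ?case using visits_nonneg[of j i 1] by simp
next
  case (Suc t)
  have "app (visits i t) j \<le> app (visits i (Suc t)) j"
    by (rule app_mono) (use Suc in blast)+
  then show ?case by (simp only: visits.simps(2)[of i t] visits.simps(2)[of i "Suc t"] add_left_mono)
qed

(* The probability of ever visiting i, scaled by the constant on the right, is superharmonic with
   defect 1 at i, hence dominates the expected number of visits. *)
lemma visits_transient_bound:
  assumes "i < n" "i \<notin> rec" "j < n"
  shows "visits i t j \<le> 1 / (1 - hitlim i i)"
proof -
  have lt: "hitlim i i < 1" using hitlim_not_rec assms by blast
  define c where "c = 1 / (1 - hitlim i i)"
  define H where "H l = (if l = i then 1 else hitlim i l)" for l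
  have c: "0 < c" "c * (1 - hitlim i i) = 1" using lt by (auto simp: c_def)
  have "visits i t j \<le> c * H j"
    using \<open>j < n\<close>
  proof (induction t arbitrary: j)
    case 0
    then show ?case using c hitlim_bounds by (auto simp: H_def)
  next
    case (Suc t)
    have "app (visits i t) j \<le> app (\<lambda>l. c * H l) j"
      by (rule app_mono[OF Suc.prems Suc.IH])
    also have "\<dots> = c * app H j" by (rule app_cmult)
    also have "app H j = hitlim i j" using hitlim_eq[OF Suc.prems] by (simp add: H_def[abs_def])
    finally show ?case using c(2) by (auto simp: H_def algebra_simps)
  qed
  moreover have "c * H j \<le> c * 1"
    using c(1) hitlim_bounds[OF \<open>j < n\<close>] by (intro mult_left_mono) (auto simp: H_def)
  ultimately have "visits i t j \<le> c * 1" by (rule order_trans)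
  then show ?thesis by (simp only: c_def mult_1_right)
qed

text \<open>The hypotheses split the indicator of \<open>i\<close> into a harmonic part
  \<open>g\<close> and a coboundary \<open>b - app b\<close>. Summed over \<open>t\<close> steps,
  the first contributes \<open>t * g\<close> and the second telescopes to something bounded.\<close>

lemma visits_cesaro:
  assumes "j < n" and dec: "\<And>j. j < n \<Longrightarrow> (if j = i then 1 else 0) = g j + b j - app b j"
    and g: "\<And>j. j < n \<Longrightarrow> app g j = g j"
  shows "(\<lambda>t. visits i t j / real t) \<longlonglongrightarrow> g j"
proof -
  obtain K where K: "\<And>j. j < n \<Longrightarrow> \<bar>b j\<bar> \<le> K"
  proof
    show "\<bar>b j\<bar> \<le> Max ((\<lambda>j. \<bar>b j\<bar>) ` {..<n})" if "j < n" for j using that by simp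
  qed
  \<comment> \<open>Inside the absolute value stands minus the \<open>t\<close>-fold image of
    \<open>b\<close> under \<open>app\<close>, and averaging does not enlarge the bound
    \<open>K\<close>.\<close>
  have *: "\<bar>visits i t j - real t * g j - b j\<bar> \<le> K" if "j < n" for t j
    using that
  proof (induction t arbitrary: j)
    case 0
    then show ?case using K by simp
  next
    case (Suc t)
    let ?f = "\<lambda>j. visits i t j - real t * g j - b j"
    have "app ?f j = app (visits i t) j - real t * g j - app b j"
      by (simp only: app_diff app_cmult g[OF Suc.prems])
    moreover have "visits i (Suc t) j = g j + b j - app b j + app (visits i t) j"
      by (simp only: visits.simps dec[OF Suc.prems])
    moreover have "real (Suc t) * g j = g j + real t * g j"
      by (simp add: distrib_right)
    ultimately have "visits i (Suc t) j - real (Suc t) * g j - b j = app ?f j"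
      by linarith
    moreover have IH: "- K \<le> ?f l \<and> ?f l \<le> K" if "l < n" for l
      using Suc.IH[OF that] by linarith
    have "app ?f j \<le> app (\<lambda>_. K) j"
      using IH by (intro app_mono[OF Suc.prems]) blast
    moreover have "app (\<lambda>_. - K) j \<le> app ?f j"
      using IH by (intro app_mono[OF Suc.prems]) blast
    moreover note app_const[OF Suc.prems]
    ultimately show ?case by (simp add: abs_le_iff)
  qed
  have "(\<lambda>t. \<bar>visits i t j / real t - g j\<bar>) \<longlonglongrightarrow> 0"
  proof (rule tendsto_sandwich[of "\<lambda>_. 0"])
    have "\<bar>visits i t j / real t - g j\<bar> \<le> (K + \<bar>b j\<bar>) / real t" if "t > 0" for t
    proof -
      have "visits i t j / real t - g j = (visits i t j - real t * g j) / real t"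
        using that by (simp add: field_simps)
      moreover have "\<bar>visits i t j - real t * g j\<bar> \<le> K + \<bar>b j\<bar>"
        using *[OF \<open>j < n\<close>, of t] by linarith
      ultimately show ?thesis using that by (simp add: divide_right_mono)
    qed
    then show "\<forall>\<^sub>F t in sequentially. \<bar>visits i t j / real t - g j\<bar> \<le> (K + \<bar>b j\<bar>) / real t"
      by (rule eventually_mono[OF eventually_gt_at_top[of 0]])
    show "(\<lambda>t. (K + \<bar>b j\<bar>) / real t) \<longlonglongrightarrow> 0" by (rule lim_const_over_n)
  qed auto
  then show ?thesis by (rule LIM_zero_cancel[OF tendsto_rabs_zero_cancel])
qed

lemma hitlim_rec_harmonic: "\<lbrakk>i \<in> rec; j < n\<rbrakk> \<Longrightarrow> app (hitlim i) j = hitlim i j"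
proof -
  assume "i \<in> rec" "j < n"
  have "(\<lambda>l. if l = i then 1 else hitlim i l) = hitlim i"
    using hitlim_rec[OF \<open>i \<in> rec\<close>] by auto
  then show ?thesis using hitlim_eq[OF \<open>j < n\<close>, of i] by simp
qed

(* Restricting to the states that can reach i makes the system nonsingular. *)
lemma hitting_cost_exists:
  assumes "i \<in> rec"
  shows "\<exists>w. \<forall>j<n. w j = hitlim i j + app (\<lambda>l. if l \<noteq> i \<and> 0 < hitlim i l then w l else 0) j"
proof -
  let ?h = "hitlim i" and ?Q = "\<lambda>j l. if l \<noteq> i \<and> 0 < hitlim i l then P j l else 0"
  have i: "i < n" using assms rec_less by blast
  have Q: "(\<Sum>l<n. ?Q j l * w l) = app (\<lambda>l. if l \<noteq> i \<and> 0 < ?h l then w l else 0) j" for j w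
    unfolding app_def by (intro sum.cong) auto
  have "\<exists>w. \<forall>j<n. w j = ?h j + (\<Sum>l<n. ?Q j l * w l)"
  proof (rule linear_system_solvable, rule ccontr)
    fix v assume "\<And>j. j < n \<Longrightarrow> v j = (\<Sum>l<n. ?Q j l * v l)"
      and nz: "\<not> (\<forall>j<n. v j = 0)"
    then have v: "v j = app (\<lambda>l. if l \<noteq> i \<and> 0 < ?h l then v l else 0) j" if "j < n" for j
      using that by (simp add: Q)
    define c where "c = Max ((\<lambda>j. \<bar>v j\<bar>) ` {..<n})"
    have c: "\<bar>v j\<bar> \<le> c" if "j < n" for j using that by (simp add: c_def)
    have "c > 0" using nz c by fastforce
    have "c \<in> (\<lambda>j. \<bar>v j\<bar>) ` {..<n}" unfolding c_def using i by (intro Max_in) auto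
    then obtain j where j: "j < n" "\<bar>v j\<bar> = c" by auto
    \<comment> \<open>A successor of a maximizer of the absolute value is a maximizer that can reach
      \<open>i\<close> but is not \<open>i\<close>; following a path towards \<open>i\<close> then
      gives a contradiction.\<close>
    have succ: "l \<noteq> i \<and> 0 < ?h l \<and> \<bar>v l\<bar> = c"
      if "j < n" "\<bar>v j\<bar> = c" "l < n" "0 < P j l" for j l
    proof -
      let ?f = "\<lambda>l. if l \<noteq> i \<and> 0 < ?h l then \<bar>v l\<bar> else 0"
      have "\<bar>app (\<lambda>l. if l \<noteq> i \<and> 0 < ?h l then v l else 0) j\<bar> \<le> app ?f j"
        unfolding app_def using P_nonneg[OF \<open>j < n\<close>]
        by (intro sum_abs[THEN order_trans] sum_mono) (auto simp: abs_mult)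
      then have "c \<le> app ?f j" using v that by simp
      then have "?f l = c"
        by (rule app_attains_max[OF \<open>j < n\<close> that(3,4)]) (use c \<open>c > 0\<close> in auto)
      then show ?thesis using \<open>c > 0\<close> by (auto split: if_splits)
    qed
    obtain l where l: "l < n" "0 < P j l" using ex_successor j by blast
    have l': "l \<noteq> i" "0 < ?h l" "\<bar>v l\<bar> = c" using succ[OF j l] by auto
    then have "(l, i) \<in> edges\<^sup>*" using hitlim_pos_reaches l i by (simp add: trancl_into_rtrancl)
    then have "i \<in> {z. z \<noteq> i \<and> \<bar>v z\<bar> = c}"
    proof (rule edges_closed)
      show "l \<in> {z. z \<noteq> i \<and> \<bar>v z\<bar> = c}" using l' by simp
      show "l \<in> {z. z \<noteq> i \<and> \<bar>v z\<bar> = c}"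
        if "j \<in> {z. z \<noteq> i \<and> \<bar>v z\<bar> = c}" "j < n" "l < n" "0 < P j l" for j l
        using succ[of j l] that by simp
    qed
    then show False by simp
  qed
  then show ?thesis by (simp add: Q)
qed

text \<open>The hitting cost \<open>w\<close> satisfies a Poisson equation. Dividing it by
  \<open>w i\<close>, which is the mean return time, splits the indicator of \<open>i\<close> as
  \<open>visits_cesaro\<close> requires, with \<open>hitlim i\<close> divided by \<open>w i\<close>
  as the harmonic part.\<close>

lemma visits_rec_limit:
  assumes "i \<in> rec"
  obtains g where "\<And>j. j < n \<Longrightarrow> (\<lambda>t. visits i t j / real t) \<longlonglongrightarrow> g j"
    and "\<And>j. j < n \<Longrightarrow> 0 \<le> g j" and "0 < g i"
proof -
  let ?h = "hitlim i"
  have i: "i < n" using assms rec_less by blast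
  obtain w where w: "\<And>j. j < n \<Longrightarrow> w j = ?h j + app (\<lambda>l. if l \<noteq> i \<and> 0 < ?h l then w l else 0) j"
    using hitting_cost_exists[OF assms] by blast
  \<comment> \<open>Where \<open>hitlim i\<close> vanishes it vanishes at all successors, so
    \<open>w\<close> is 0 there. Removing the single state \<open>i\<close> thus has the same effect
    as the restriction in the equation for \<open>w\<close>.\<close>
  have w0: "w j = 0" if "j < n" "?h j = 0" for j
  proof -
    have "?h l = 0" if "l < n" "0 < P j l" for l
      by (rule app_attains_min[OF \<open>j < n\<close> that])
        (use hitlim_rec_harmonic[OF assms \<open>j < n\<close>] \<open>?h j = 0\<close> hitlim_bounds in auto)
    then have "app (\<lambda>l. if l \<noteq> i \<and> 0 < ?h l then w l else 0) j = 0"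
      unfolding app_def using P_nonneg[OF \<open>j < n\<close>] by (intro sum.neutral) force
    then show ?thesis using w[OF \<open>j < n\<close>] \<open>?h j = 0\<close> by simp
  qed
  let ?d = "\<lambda>j. if j = i then 1 else 0 :: real"
  have "app (\<lambda>l. if l \<noteq> i \<and> 0 < ?h l then w l else 0) j = app (\<lambda>l. w l - w i * ?d l) j" for j
    by (rule app_cong) (use w0 hitlim_bounds in \<open>force simp: order_less_le\<close>)
  then have poisson: "w j = ?h j + (app w j - w i * app ?d j)" if "j < n" for j
    using w[OF that] by (simp add: app_diff app_cmult)
  \<comment> \<open>Otherwise \<open>hitlim i\<close> equals \<open>w - app w\<close>, and
    \<open>w - t * hitlim i\<close> is the \<open>t\<close>-fold image of \<open>w\<close> under
    \<open>app\<close>. It is bounded below by the minimum of \<open>w\<close>, which fails at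
    \<open>i\<close> for large \<open>t\<close>.\<close>
  have "w i \<noteq> 0"
  proof
    assume wi: "w i = 0"
    have h: "?h j = w j - app w j" if "j < n" for j using poisson[OF that] wi by simp
    obtain K where K: "\<And>j. j < n \<Longrightarrow> K \<le> w j"
    proof
      show "Min (w ` {..<n}) \<le> w j" if "j < n" for j using that by simp
    qed
    have "K \<le> w j - real t * ?h j" if "j < n" for t j
      using that
    proof (induction t arbitrary: j)
      case (Suc t)
      have "app (\<lambda>_. K) j \<le> app (\<lambda>j. w j - real t * ?h j) j"
        by (rule app_mono[OF Suc.prems Suc.IH])
      also have "\<dots> = app w j - real t * ?h j"
        by (simp only: app_diff app_cmult hitlim_rec_harmonic[OF assms Suc.prems])
      also have "\<dots> = w j - real (Suc t) * ?h j"
        using h[OF Suc.prems] by (simp add: distrib_right)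
      finally show ?case using Suc.prems by simp
    qed (use K in simp)
    then have bound: "K \<le> w i - real t" for t using hitlim_rec[OF assms] i by (metis mult_1_right)
    obtain t where "w i - K < real t" using reals_Archimedean2 by blast
    then show False using bound[of t] by linarith
  qed
  define g where "g j = 1 / w i * ?h j" for j
  define b where "b j = ?d j - 1 / w i * w j" for j
  have g_harm: "app g j = g j" if "j < n" for j
    unfolding g_def[abs_def] app_cmult hitlim_rec_harmonic[OF assms that] ..
  have dec: "?d j = g j + b j - app b j" if "j < n" for j
  proof -
    have "w i * app ?d j = ?h j - w j + app w j" using poisson[OF that] by linarith
    then have "app ?d j = 1 / w i * (?h j - w j + app w j)" using \<open>w i \<noteq> 0\<close> by (simp add: field_simps)
    then show ?thesis
      unfolding g_def b_def[abs_def] app_diff app_cmult by (simp add: algebra_simps)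
  qed
  have lim: "(\<lambda>t. visits i t j / real t) \<longlonglongrightarrow> g j" if "j < n" for j
    by (rule visits_cesaro[OF that, of i g b]) (use dec g_harm in auto)
  have nn: "0 \<le> g j" if "j < n" for j
    by (rule LIMSEQ_le_const[OF lim[OF that]]) (use visits_nonneg that in auto)
  have "g i \<noteq> 0" using hitlim_rec[OF assms] \<open>w i \<noteq> 0\<close> by (simp add: g_def)
  then have "0 < g i" using nn[OF i] by simp
  then show thesis using that[OF lim nn] by blast
qed

subsection \<open>Discounted occupancies\<close>

text \<open>At a minimizer of \<open>z\<close> with value \<open>c\<close>, averaging gives
  \<open>\<gamma> * c \<le> c\<close>, hence \<open>0 \<le> c\<close> because
  \<open>\<gamma> < 1\<close>.\<close>

lemma discounted_nonneg:
  assumes "0 \<le> \<gamma>" "\<gamma> < 1" and z: "\<And>j. j < n \<Longrightarrow> \<gamma> * app z j \<le> z j" and "j < n"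
  shows "0 \<le> z j"
proof -
  define c where "c = Min (z ` {..<n})"
  have c: "c \<le> z j" if "j < n" for j using that by (simp add: c_def)
  have "c \<in> z ` {..<n}" unfolding c_def using \<open>j < n\<close> by (intro Min_in) auto
  then obtain k where k: "k < n" "z k = c" by auto
  have "c \<le> app z k" using app_mono[OF k(1), of "\<lambda>_. c" z] c k(1) by simp
  then have "\<gamma> * c \<le> c" using z[OF k(1)] k(2) \<open>0 \<le> \<gamma>\<close> by (meson mult_left_mono order_trans order_refl)
  then have "0 \<le> (1 - \<gamma>) * c" by (simp add: algebra_simps)
  then have "0 \<le> c" using \<open>\<gamma> < 1\<close> by (simp add: zero_le_mult_iff)
  then show ?thesis using c[OF \<open>j < n\<close>] by linarith
qed

lemma discounted_unique:
  assumes "0 \<le> \<gamma>" "\<gamma> < 1"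
    and z: "\<And>j. j < n \<Longrightarrow> z j = a j + \<gamma> * app z j"
    and z': "\<And>j. j < n \<Longrightarrow> z' j = a j + \<gamma> * app z' j" and "j < n"
  shows "z j = z' j"
proof -
  have "0 \<le> z j - z' j"
    by (rule discounted_nonneg[OF assms(1,2) _ \<open>j < n\<close>, of "\<lambda>j. z j - z' j"])
       (use z z' in \<open>simp add: app_diff algebra_simps\<close>)
  moreover have "0 \<le> z' j - z j"
    by (rule discounted_nonneg[OF assms(1,2) _ \<open>j < n\<close>, of "\<lambda>j. z' j - z j"])
       (use z z' in \<open>simp add: app_diff algebra_simps\<close>)
  ultimately show ?thesis by simp
qed

lemma discounted_exists:
  assumes "0 \<le> \<gamma>" "\<gamma> < 1"
  shows "\<exists>z. \<forall>j<n. z j = a j + \<gamma> * app z j"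
proof -
  have eq: "(\<Sum>l<n. \<gamma> * P j l * v l) = \<gamma> * app v j" for v j
    by (simp add: app_def sum_distrib_left mult.assoc)
  have "\<exists>w. \<forall>j<n. w j = a j + (\<Sum>l<n. \<gamma> * P j l * w l)"
  proof (rule linear_system_solvable)
    fix v assume v: "\<And>j. j < n \<Longrightarrow> v j = (\<Sum>l<n. \<gamma> * P j l * v l)"
    have "v j = (\<lambda>_. 0) j" if "j < n" for j
      by (rule discounted_unique[OF assms _ _ that, of v "\<lambda>_. 0" "\<lambda>_. 0"]) (use v eq in auto)
    then show "\<forall>j<n. v j = 0" by simp
  qed
  then show ?thesis by (simp add: eq)
qed

text \<open>The inverse of \<open>1 - \<gamma> P\<close> applied to \<open>a\<close>. A choice
  operator is used since the equation fixes only the values below \<open>n\<close>.\<close>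

definition resolvent :: "real \<Rightarrow> (nat \<Rightarrow> real) \<Rightarrow> nat \<Rightarrow> real" where
  "resolvent \<gamma> a = (SOME z. \<forall>j<n. z j = a j + \<gamma> * app z j)"

definition occ :: "real \<Rightarrow> nat \<Rightarrow> real" where
  "occ \<gamma> i = (\<Sum>j<n. resolvent \<gamma> (\<lambda>j. if j = i then 1 else 0) j)"

context
  fixes \<gamma> :: real
  assumes \<gamma>: "0 \<le> \<gamma>" "\<gamma> < 1"
begin

lemma resolvent_eq: "j < n \<Longrightarrow> resolvent \<gamma> a j = a j + \<gamma> * app (resolvent \<gamma> a) j"
  using someI_ex[OF discounted_exists[OF \<gamma>, of a]] by (simp add: resolvent_def)

lemma discounted_ge:
  assumes "\<And>j. j < n \<Longrightarrow> z j = a j + \<gamma> * app z j" "\<And>j. j < n \<Longrightarrow> 0 \<le> a j" "j < n"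
  shows "a j \<le> z j"
proof -
  have "0 \<le> z j" if "j < n" for j
    by (rule discounted_nonneg[OF \<gamma> _ that]) (use assms in fastforce)
  then have "0 \<le> app z j" using app_mono[OF \<open>j < n\<close>, of "\<lambda>_. 0" z] \<open>j < n\<close> by simp
  then show ?thesis using assms(1)[OF \<open>j < n\<close>] \<gamma> by simp
qed

text \<open>By linearity and uniqueness, \<open>z\<close> is the combination of the resolvents of
  the indicators with coefficients \<open>a i\<close>; summation over the starting states turns each
  resolvent into an occupancy.\<close>

lemma sum_discounted:
  assumes z: "\<And>j. j < n \<Longrightarrow> z j = a j + \<gamma> * app z j"
  shows "(\<Sum>j<n. z j) = (\<Sum>i<n. occ \<gamma> i * a i)"
proof -
  let ?y = "\<lambda>i. resolvent \<gamma> (\<lambda>j. if j = i then 1 else 0)"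
  have "z j = (\<Sum>i<n. a i * ?y i j)" if "j < n" for j
  proof (rule discounted_unique[OF \<gamma> z _ that])
    fix j assume j: "j < n"
    have "(\<Sum>i<n. a i * ?y i j) = (\<Sum>i<n. a i * ((if j = i then 1 else 0) + \<gamma> * app (?y i) j))"
      by (intro sum.cong refl) (simp only: resolvent_eq[OF j])
    also have "\<dots> = (\<Sum>i<n. (if j = i then a i else 0)) + (\<Sum>i<n. \<gamma> * app (\<lambda>l. a i * ?y i l) j)"
      by (simp only: app_cmult flip: sum.distrib) (auto intro!: sum.cong simp: algebra_simps)
    also have "\<dots> = a j + \<gamma> * app (\<lambda>l. \<Sum>i<n. a i * ?y i l) j"
      using j by (simp add: app_sum sum_distrib_left)
    finally show "(\<Sum>i<n. a i * ?y i j) = a j + \<gamma> * app (\<lambda>l. \<Sum>i<n. a i * ?y i l) j" .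
  qed
  then have "(\<Sum>j<n. z j) = (\<Sum>j<n. \<Sum>i<n. a i * ?y i j)" by simp
  also have "\<dots> = (\<Sum>i<n. \<Sum>j<n. a i * ?y i j)" by (rule sum.swap)
  also have "\<dots> = (\<Sum>i<n. occ \<gamma> i * a i)"
    by (simp add: occ_def sum_distrib_left mult.commute)
  finally show ?thesis .
qed

lemma resolvent_unit_nonneg: "j < n \<Longrightarrow> 0 \<le> resolvent \<gamma> (\<lambda>j. if j = i then 1 else 0) j"
  by (rule discounted_nonneg[OF \<gamma>, of "resolvent \<gamma> (\<lambda>j. if j = i then 1 else 0)"])
    (use resolvent_eq[of _ "\<lambda>j. if j = i then 1 else 0"] in auto)

lemma resolvent_unit_le_occ: "j < n \<Longrightarrow> resolvent \<gamma> (\<lambda>j. if j = i then 1 else 0) j \<le> occ \<gamma> i"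
  unfolding occ_def using resolvent_unit_nonneg by (intro member_le_sum) auto

lemma occ_ge_1: assumes "i < n" shows "1 \<le> occ \<gamma> i"
proof -
  have "1 \<le> resolvent \<gamma> (\<lambda>j. if j = i then 1 else 0) i"
    using discounted_ge[of "resolvent \<gamma> (\<lambda>j. if j = i then 1 else 0)" "\<lambda>j. if j = i then 1 else 0" i]
      resolvent_eq assms by simp
  then show ?thesis using resolvent_unit_le_occ[OF assms, of i] by linarith
qed

lemma sum_occ: "(\<Sum>i<n. occ \<gamma> i) = real n / (1 - \<gamma>)"
proof -
  have "1 / (1 - \<gamma>) = 1 + \<gamma> * app (\<lambda>_. 1 / (1 - \<gamma>)) j" if "j < n" for j
    using that \<gamma> by (simp add: field_simps)
  from sum_discounted[of "\<lambda>_. 1 / (1 - \<gamma>)" "\<lambda>_. 1", OF this] show ?thesis by simp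
qed

text \<open>Split at time \<open>t\<close>: discounting only decreases the earlier visits, and the
  later ones contribute at most \<open>\<gamma> ^ t\<close> times a discounted count that
  \<open>occ\<close> dominates.\<close>

lemma resolvent_le_visits:
  assumes "j < n"
  shows "resolvent \<gamma> (\<lambda>j. if j = i then 1 else 0) j \<le> visits i t j + \<gamma> ^ t * occ \<gamma> i"
  using assms
proof (induction t arbitrary: j)
  case 0
  then show ?case using resolvent_unit_le_occ by simp
next
  case (Suc t)
  let ?y = "resolvent \<gamma> (\<lambda>j. if j = i then 1 else 0)"
  have "app ?y j \<le> app (\<lambda>j. visits i t j + \<gamma> ^ t * occ \<gamma> i) j"
    by (rule app_mono[OF Suc.prems Suc.IH])
  also have "\<dots> = app (visits i t) j + \<gamma> ^ t * occ \<gamma> i"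
    using Suc.prems by (simp add: app_add)
  finally have "\<gamma> * app ?y j \<le> \<gamma> * app (visits i t) j + \<gamma> ^ Suc t * occ \<gamma> i"
    using \<gamma> mult_left_mono[OF _ \<gamma>(1)] by (fastforce simp: distrib_left)
  moreover have "0 \<le> app (visits i t) j"
    using app_mono[OF Suc.prems, of "\<lambda>_. 0" "visits i t"] visits_nonneg Suc.prems by simp
  then have "\<gamma> * app (visits i t) j \<le> app (visits i t) j"
    using \<gamma> by (simp add: mult_left_le_one_le)
  ultimately show ?case
    using resolvent_eq[OF Suc.prems, of "\<lambda>j. if j = i then 1 else 0"] by simp
qed

text \<open>With \<open>y\<close> the resolvent of the indicator of \<open>i\<close>, that indicator
  equals \<open>(y - app y) + (1 - \<gamma>) * app y\<close>. Over \<open>t\<close> steps the first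
  summand telescopes to at most \<open>y\<close>, and the second adds at most
  \<open>(1 - \<gamma>) * occ \<gamma> i\<close> per step.\<close>

lemma visits_le_occ:
  assumes "j < n"
  shows "visits i t j \<le> ((1 - \<gamma>) * real t + 1) * occ \<gamma> i"
proof -
  let ?y = "resolvent \<gamma> (\<lambda>j. if j = i then 1 else 0)"
  have "visits i t j \<le> (1 - \<gamma>) * real t * occ \<gamma> i + ?y j"
    using assms
  proof (induction t arbitrary: j)
    case 0
    then show ?case using resolvent_unit_nonneg by simp
  next
    case (Suc t)
    have "app (visits i t) j \<le> app (\<lambda>j. (1 - \<gamma>) * real t * occ \<gamma> i + ?y j) j"
      by (rule app_mono[OF Suc.prems Suc.IH])
    also have "\<dots> = (1 - \<gamma>) * real t * occ \<gamma> i + app ?y j"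
      using Suc.prems by (simp add: app_add)
    finally have 1: "app (visits i t) j \<le> (1 - \<gamma>) * real t * occ \<gamma> i + app ?y j" .
    have "app ?y j \<le> app (\<lambda>_. occ \<gamma> i) j"
      by (rule app_mono[OF Suc.prems resolvent_unit_le_occ])
    then have "(1 - \<gamma>) * app ?y j \<le> (1 - \<gamma>) * occ \<gamma> i"
      using \<gamma> Suc.prems by (intro mult_left_mono) auto
    then have "app ?y j \<le> \<gamma> * app ?y j + (1 - \<gamma>) * occ \<gamma> i"
      by (simp add: algebra_simps)
    then show ?case
      using 1 resolvent_eq[OF Suc.prems, of "\<lambda>j. if j = i then 1 else 0"]
      by (simp add: algebra_simps)
  qed
  also have "\<dots> \<le> ((1 - \<gamma>) * real t + 1) * occ \<gamma> i"
    using resolvent_unit_le_occ[OF assms, of i] by (simp add: distrib_right)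
  finally show ?thesis .
qed

text \<open>Let \<open>t\<close> tend to infinity in \<open>resolvent_le_visits\<close>. Transience
  bounds the increasing visit counts, so that \<open>lim\<close> is a genuine limit.\<close>

lemma occ_transient:
  assumes "i < n" "i \<notin> rec"
  shows "occ \<gamma> i \<le> real n * lim (\<lambda>t. (\<Sum>j<n. visits i t j) / real n)"
proof -
  let ?s = "\<lambda>t. (\<Sum>j<n. visits i t j) / real n"
  have n: "0 < n" using assms by simp
  have "incseq ?s"
    by (intro incseq_SucI divide_right_mono sum_mono visits_mono) auto
  moreover have "?s t \<le> (\<Sum>j<n. 1 / (1 - hitlim i i)) / real n" for t
    using visits_transient_bound[OF assms] by (intro divide_right_mono sum_mono) auto
  ultimately have "convergent ?s"
    by (metis incseq_convergent convergentI)
  then have lim: "?s \<longlonglongrightarrow> lim ?s" by (simp add: convergent_LIMSEQ_iff)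
  have "occ \<gamma> i \<le> real n * ?s t + real n * (\<gamma> ^ t * occ \<gamma> i)" for t
  proof -
    have "occ \<gamma> i \<le> (\<Sum>j<n. visits i t j + \<gamma> ^ t * occ \<gamma> i)"
      unfolding occ_def by (rule sum_mono) (simp add: resolvent_le_visits[unfolded occ_def])
    then show ?thesis using n by (simp add: sum.distrib)
  qed
  moreover have "(\<lambda>t. real n * ?s t + real n * (\<gamma> ^ t * occ \<gamma> i)) \<longlonglongrightarrow> real n * lim ?s + real n * (0 * occ \<gamma> i)"
    by (intro tendsto_intros lim LIMSEQ_realpow_zero \<gamma>)
  ultimately show ?thesis
    using LIMSEQ_le_const by (metis (no_types, lifting) add.right_neutral mult_zero_left mult_zero_right)
qed

text \<open>Convergence and positivity come from \<open>visits_rec_limit\<close>; the upper bound is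
  \<open>visits_le_occ\<close> divided by \<open>t\<close>, in the limit.\<close>

lemma occ_recurrent:
  assumes "i \<in> rec"
  obtains \<mu> where "(\<lambda>t. 1 / real t * ((\<Sum>j<n. visits i t j) / real n)) \<longlonglongrightarrow> \<mu>"
    and "0 < \<mu>" and "\<mu> \<le> (1 - \<gamma>) * occ \<gamma> i"
proof -
  obtain g where g: "\<And>j. j < n \<Longrightarrow> (\<lambda>t. visits i t j / real t) \<longlonglongrightarrow> g j"
    and nn: "\<And>j. j < n \<Longrightarrow> 0 \<le> g j" and pos: "0 < g i"
    using visits_rec_limit[OF assms] by blast
  have i: "i < n" using assms rec_less by blast
  let ?s = "\<lambda>t. 1 / real t * ((\<Sum>j<n. visits i t j) / real n)"
  have "(\<lambda>t. (\<Sum>j<n. visits i t j / real t) / real n) \<longlonglongrightarrow> (\<Sum>j<n. g j) / real n"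
    using i g by (intro tendsto_intros) auto
  then have lim: "?s \<longlonglongrightarrow> (\<Sum>j<n. g j) / real n"
    by (simp add: sum_divide_distrib mult.commute)
  have "0 < (\<Sum>j<n. g j) / real n"
    using i nn pos by (intro divide_pos_pos sum_pos2[of _ i]) auto
  moreover have "(\<Sum>j<n. g j) / real n \<le> (1 - \<gamma>) * occ \<gamma> i"
  proof (rule LIMSEQ_le[OF lim])
    have "(\<lambda>t. (1 - \<gamma>) * occ \<gamma> i + occ \<gamma> i / real t) \<longlonglongrightarrow> (1 - \<gamma>) * occ \<gamma> i + 0"
      by (intro tendsto_intros lim_const_over_n)
    then show "(\<lambda>t. (1 - \<gamma>) * occ \<gamma> i + occ \<gamma> i / real t) \<longlonglongrightarrow> (1 - \<gamma>) * occ \<gamma> i" by simp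
    have "?s t \<le> (1 - \<gamma>) * occ \<gamma> i + occ \<gamma> i / real t" if "1 \<le> t" for t
    proof -
      have "(\<Sum>j<n. visits i t j) \<le> (\<Sum>j<n. ((1 - \<gamma>) * real t + 1) * occ \<gamma> i)"
        by (intro sum_mono visits_le_occ) simp
      then have "(\<Sum>j<n. visits i t j) / real n \<le> ((1 - \<gamma>) * real t + 1) * occ \<gamma> i"
        using i by (simp add: pos_divide_le_eq mult.commute)
      then have "1 / real t * ((\<Sum>j<n. visits i t j) / real n) \<le> 1 / real t * (((1 - \<gamma>) * real t + 1) * occ \<gamma> i)"
        by (rule mult_left_mono) simp
      also have "\<dots> = (1 - \<gamma>) * occ \<gamma> i + occ \<gamma> i / real t"
        using that by (simp add: field_simps)
      finally show ?thesis .
    qed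
    then show "\<exists>N. \<forall>t\<ge>N. ?s t \<le> (1 - \<gamma>) * occ \<gamma> i + occ \<gamma> i / real t" by blast
  qed
  ultimately show thesis using that[OF lim] by blast
qed

end

subsection \<open>Path probabilities\<close>

context
  fixes A :: "real mat"
  assumes A: "\<And>j l. \<lbrakk>j < n; l < n\<rbrakk> \<Longrightarrow> A $$ (j, l) = P j l"
begin

abbreviation paths :: "nat \<Rightarrow> (nat \<Rightarrow> nat) set" where
  "paths k \<equiv> {..k} \<rightarrow>\<^sub>E {..<n}"

lemma path_prob_alt:
  "path_prob n A d k E = (\<Sum>x\<in>paths k. if E x then d (x 0) * (\<Prod>l<k. A $$ (x l, x (Suc l))) else 0)"
  unfolding path_prob_def by (subst sum.inter_filter[symmetric]) (auto intro: finite_PiE)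

lemma path_start: "x \<in> paths k \<Longrightarrow> x 0 < n"
  by (auto dest: PiE_mem)

lemma path_prob_start:
  "path_prob n A d k E = (\<Sum>j<n. d j * path_prob n A (\<lambda>l. if l = j then 1 else 0) k E)"
proof -
  have "(\<Sum>j<n. d j * path_prob n A (\<lambda>l. if l = j then 1 else 0) k E) =
    (\<Sum>x\<in>paths k. \<Sum>j<n. if x 0 = j then (if E x then d j * (\<Prod>l<k. A $$ (x l, x (Suc l))) else 0) else 0)"
    unfolding path_prob_alt sum_distrib_left by (subst sum.swap) (auto intro!: sum.cong)
  also have "\<dots> = path_prob n A d k E"
    unfolding path_prob_alt using path_start by (intro sum.cong) auto
  finally show ?thesis ..
qed

lemma path_prob_0:
  assumes "j < n"
  shows "path_prob n A (\<lambda>l. if l = j then 1 else 0) 0 E = (if E (\<lambda>m. if m = 0 then j else undefined) then 1 else 0)"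
proof -
  \<comment> \<open>Paths are extensional functions, so a path of length 0 is
    \<open>undefined\<close> at all positive times.\<close>
  let ?c = "\<lambda>l m. if m = (0::nat) then l else undefined :: nat"
  have "path_prob n A (\<lambda>l. if l = j then 1 else 0) 0 E = (\<Sum>x\<in>paths 0. if E x \<and> x 0 = j then 1 else 0)"
    unfolding path_prob_alt by (intro sum.cong) auto
  also have "\<dots> = (\<Sum>l<n. if E (?c l) \<and> l = j then 1 else 0)"
  proof (rule sum.reindex_bij_witness[of _ ?c "\<lambda>x. x 0"])
    fix x assume x: "x \<in> paths 0"
    then show "?c (x 0) = x" by (auto simp: fun_eq_iff PiE_def extensional_def)
    then show "(if E (?c (x 0)) \<and> x 0 = j then 1 else 0) = (if E x \<and> x 0 = j then 1 else 0)" by simp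
    show "x 0 \<in> {..<n}" using path_start[OF x] by simp
  qed (auto simp: PiE_def extensional_def)
  also have "\<dots> = (\<Sum>l<n. if l = j then (if E (?c j) then 1 else 0) else 0)"
    by (intro sum.cong) auto
  also have "\<dots> = (if E (?c j) then 1 else 0)" using assms by simp
  finally show ?thesis .
qed

text \<open>First-step analysis: splitting off the initial state is a bijection onto pairs of a
  state and a shorter path, inverted by \<open>case_nat\<close>. The shorter path then starts with
  distribution \<open>P j\<close>.\<close>

lemma path_prob_Suc:
  assumes "j < n"
  shows "path_prob n A (\<lambda>l. if l = j then 1 else 0) (Suc k) E =
    app (\<lambda>l. path_prob n A (\<lambda>m. if m = l then 1 else 0) k (\<lambda>x. E (case_nat j x))) j"
proof -
  let ?w = "\<lambda>x. \<Prod>l<k. A $$ (x l, x (Suc l))"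
  have "path_prob n A (\<lambda>l. if l = j then 1 else 0) (Suc k) E =
      (\<Sum>(l, y)\<in>{..<n} \<times> paths k. if E (case_nat l y) \<and> l = j then A $$ (l, y 0) * ?w y else 0)"
    unfolding path_prob_alt
  proof (rule sum.reindex_bij_witness[of _ "\<lambda>(l, y). case_nat l y" "\<lambda>x. (x 0, \<lambda>m. x (Suc m))"])
    fix x assume x: "x \<in> paths (Suc k)"
    show 1: "(\<lambda>(l, y). case_nat l y) (x 0, \<lambda>m. x (Suc m)) = x"
      by (auto simp: fun_eq_iff split: nat.split)
    show "(x 0, \<lambda>m. x (Suc m)) \<in> {..<n} \<times> paths k"
      using x by (auto simp: PiE_def extensional_def)
    show "(case (x 0, \<lambda>m. x (Suc m)) of (l, y) \<Rightarrow> if E (case_nat l y) \<and> l = j then A $$ (l, y 0) * ?w y else 0) =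
        (if E x then (if x 0 = j then 1 else 0) * (\<Prod>l<Suc k. A $$ (x l, x (Suc l))) else 0)"
      using 1 by (simp add: prod.lessThan_Suc_shift del: prod.lessThan_Suc)
  next
    fix ly assume "ly \<in> {..<n} \<times> paths k"
    then show "(\<lambda>(l, y). case_nat l y) ly \<in> paths (Suc k)"
      by (auto simp: PiE_def extensional_def split: nat.split)
  qed auto
  also have "\<dots> = (\<Sum>l<n. if l = j then (\<Sum>y\<in>paths k. if E (case_nat j y) then A $$ (j, y 0) * ?w y else 0) else 0)"
    unfolding sum.cartesian_product[symmetric] by (intro sum.cong) auto
  also have "\<dots> = (\<Sum>y\<in>paths k. if E (case_nat j y) then A $$ (j, y 0) * ?w y else 0)"
    using assms by simp
  also have "\<dots> = path_prob n A (P j) k (\<lambda>x. E (case_nat j x))"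
    unfolding path_prob_alt using path_start A assms by (intro sum.cong) auto
  also have "\<dots> = app (\<lambda>l. path_prob n A (\<lambda>m. if m = l then 1 else 0) k (\<lambda>x. E (case_nat j x))) j"
    unfolding app_def by (rule path_prob_start)
  finally show ?thesis .
qed

lemma path_prob_True: "j < n \<Longrightarrow> path_prob n A (\<lambda>l. if l = j then 1 else 0) k (\<lambda>_. True) = 1"
proof (induction k arbitrary: j)
  case (Suc k)
  have "app (\<lambda>l. path_prob n A (\<lambda>m. if m = l then 1 else 0) k (\<lambda>_. True)) j = app (\<lambda>_. 1) j"
    by (rule app_cong) (use Suc.IH in simp)
  then show ?case using Suc.prems by (simp add: path_prob_Suc)
qed (simp add: path_prob_0)

lemma path_prob_visit_eq_hit:
  "j < n \<Longrightarrow> path_prob n A (\<lambda>l. if l = j then 1 else 0) k (\<lambda>x. \<exists>l\<in>{1..k}. x l = i) = hit i k j"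
proof (induction k arbitrary: j)
  case (Suc k)
  have *: "(\<exists>l\<in>{1..Suc k}. case_nat j x l = i) \<longleftrightarrow> x 0 = i \<or> (\<exists>l\<in>{1..k}. x l = i)" for x :: "nat \<Rightarrow> nat"
  proof -
    have "{1..Suc k} = Suc ` insert 0 {1..k}" by (auto simp: image_iff gr0_conv_Suc)
    then show ?thesis by (simp only: bex_simps nat.case)
  qed
  have "path_prob n A (\<lambda>m. if m = l then 1 else 0) k (\<lambda>x. x 0 = i \<or> (\<exists>l\<in>{1..k}. x l = i)) =
      (if l = i then 1 else hit i k l)" if "l < n" for l
  proof -
    have "path_prob n A (\<lambda>m. if m = l then 1 else 0) k (\<lambda>x. x 0 = i \<or> (\<exists>l\<in>{1..k}. x l = i)) =
      path_prob n A (\<lambda>m. if m = l then 1 else 0) k (\<lambda>x. l = i \<or> (\<exists>l\<in>{1..k}. x l = i))"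
      unfolding path_prob_alt by (intro sum.cong) auto
    then show ?thesis using Suc.IH[OF that] path_prob_True[OF that] by (cases "l = i") simp_all
  qed
  then show ?case
    unfolding path_prob_Suc[OF Suc.prems] * by (auto intro: app_cong)
qed (simp add: path_prob_0)

lemma sum_path_prob_eq_visits:
  "j < n \<Longrightarrow> (\<Sum>k<t. path_prob n A (\<lambda>l. if l = j then 1 else 0) k (\<lambda>x. x k = i)) = visits i t j"
proof (induction t arbitrary: j)
  case (Suc t)
  have "(\<Sum>k<Suc t. path_prob n A (\<lambda>l. if l = j then 1 else 0) k (\<lambda>x. x k = i)) =
     (if j = i then 1 else 0) + (\<Sum>k<t. app (\<lambda>l. path_prob n A (\<lambda>m. if m = l then 1 else 0) k (\<lambda>x. x k = i)) j)"
    unfolding sum.lessThan_Suc_shift using Suc.prems by (simp add: path_prob_0 path_prob_Suc)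
  also have "\<dots> = (if j = i then 1 else 0) + app (visits i t) j"
    using Suc.IH by (simp add: app_sum[symmetric] cong: app_cong)
  finally show ?case by simp
qed simp

lemma lim_path_prob_return:
  "i < n \<Longrightarrow> lim (\<lambda>k. path_prob n A (\<lambda>j. if j = i then 1 else 0) k (\<lambda>x. \<exists>l\<in>{1..k}. x l = i)) = hitlim i i"
  by (simp only: path_prob_visit_eq_hit hitlim_def)

lemma sum_path_prob_uniform:
  "(\<Sum>k<t. path_prob n A (\<lambda>_. 1 / real n) k (\<lambda>x. x k = i)) = (\<Sum>j<n. visits i t j) / real n"
proof -
  have "(\<Sum>k<t. path_prob n A (\<lambda>_. 1 / real n) k (\<lambda>x. x k = i)) =
    (\<Sum>j<n. \<Sum>k<t. 1 / real n * path_prob n A (\<lambda>l. if l = j then 1 else 0) k (\<lambda>x. x k = i))"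
    by (subst path_prob_start) (rule sum.swap)
  also have "\<dots> = (\<Sum>j<n. 1 / real n * visits i t j)"
    by (intro sum.cong refl) (simp only: lessThan_iff sum_path_prob_eq_visits sum_distrib_left[symmetric])
  finally show ?thesis by (simp add: sum_divide_distrib)
qed

end

end

section \<open>Finite Markov decision processes\<close>

text \<open>A state recurrent for \<open>P'\<close> reaches only states recurrent for
  \<open>P'\<close>, hence never \<open>i\<close>. Both chains have the same edges along its paths,
  so reachability from it is the same in both.\<close>

lemma rec_subset_if_rows_agree:
  assumes "finite_chain n P" "finite_chain n P'"
    and agree: "\<And>j l. \<lbrakk>j < n; l < n; j \<noteq> i\<rbrakk> \<Longrightarrow> P j l = P' j l"
    and i: "i \<notin> finite_chain.rec n P'"
  shows "finite_chain.rec n P' \<subseteq> finite_chain.rec n P"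
proof
  interpret P: finite_chain n P by fact
  interpret P': finite_chain n P' by fact
  have edge: "(j, l) \<in> P.edges \<longleftrightarrow> (j, l) \<in> P'.edges" if "j \<in> P'.rec" for j l
  proof -
    have "j \<noteq> i" using i that by blast
    then show ?thesis using agree[of j l] by (auto simp: P.edges_def P'.edges_def)
  qed
  have 1: "(j, l) \<in> P'.edges\<^sup>*" if "(j, l) \<in> P.edges\<^sup>*" "j \<in> P'.rec" for j l
    using that
  proof (induction rule: rtrancl_induct)
    case (step k l)
    then have "k \<in> P'.rec" using P'.rec_edges by blast
    then show ?case using step edge by (meson rtrancl.rtrancl_into_rtrancl)
  qed simp
  have 2: "(j, l) \<in> P.edges\<^sup>*" if "(j, l) \<in> P'.edges\<^sup>*" "j \<in> P'.rec" for j l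
    using that
  proof (induction rule: rtrancl_induct)
    case (step k l)
    then have "k \<in> P'.rec" using P'.rec_edges by blast
    then show ?case using step edge by (meson rtrancl.rtrancl_into_rtrancl)
  qed simp
  fix k assume k: "k \<in> P'.rec"
  have "(l, k) \<in> P.edges\<^sup>*" if "(k, l) \<in> P.edges\<^sup>*" for l
  proof -
    have l: "(k, l) \<in> P'.edges\<^sup>*" using 1[OF that k] .
    then have "(l, k) \<in> P'.edges\<^sup>*" using k by (simp add: P'.rec_def)
    then show ?thesis using 2 P'.rec_edges[OF k l] by blast
  qed
  then show "k \<in> P.rec" using P'.rec_less[OF k] by (simp add: P.rec_def)
qed

locale fin_mdp =
  fixes M :: "'a mdp"
  assumes M: "finite_mdp M"
begin

abbreviation "n \<equiv> nstates M"
abbreviation "\<gamma> \<equiv> discount M"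
abbreviation "chain \<pi> \<equiv> \<lambda>i. trans M i (\<pi> i)"
abbreviation "recs \<pi> \<equiv> finite_chain.rec n (chain \<pi>)"
abbreviation "occs \<pi> \<equiv> finite_chain.occ n (chain \<pi>) \<gamma>"

text \<open>The Q-value of one state-action pair with continuation \<open>v\<close>. It is
  independent of policies, so actions can be compared at a single state.\<close>

definition backup :: "(nat \<Rightarrow> real) \<Rightarrow> nat \<Rightarrow> 'a \<Rightarrow> real" where
  "backup v i a = (\<Sum>j<n. trans M i a j * reward M i a j) + \<gamma> * (\<Sum>j<n. trans M i a j * v j)"

abbreviation V :: "(nat \<Rightarrow> 'a) \<Rightarrow> nat \<Rightarrow> real" where
  "V \<pi> i \<equiv> val M \<pi> $ i"

definition adv :: "(nat \<Rightarrow> 'a) \<Rightarrow> nat \<Rightarrow> 'a \<Rightarrow> real" where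
  "adv \<pi> i a = backup (V \<pi>) i a - V \<pi> i"

definition total :: "(nat \<Rightarrow> 'a) \<Rightarrow> real" where
  "total \<pi> = (\<Sum>i<n. V \<pi> i)"

lemma n_pos: "0 < n"
  and \<gamma>: "0 \<le> \<gamma>" "\<gamma> < 1"
  and trans_nonneg: "\<lbrakk>i < n; a \<in> admissible M i; j < n\<rbrakk> \<Longrightarrow> 0 \<le> trans M i a j"
  and trans_sum: "\<lbrakk>i < n; a \<in> admissible M i\<rbrakk> \<Longrightarrow> (\<Sum>j<n. trans M i a j) = 1"
  using M by (auto simp: finite_mdp_def)

lemma policy_admissible: "\<lbrakk>\<pi> \<in> policies M; i < n\<rbrakk> \<Longrightarrow> \<pi> i \<in> admissible M i"
  by (auto simp: policies_def)

lemma policy_update: "\<lbrakk>\<pi> \<in> policies M; i < n; a \<in> admissible M i\<rbrakk> \<Longrightarrow> \<pi>(i := a) \<in> policies M"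
  by (auto simp: policies_def PiE_def extensional_def)

lemma finite_admissible: "i < n \<Longrightarrow> finite (admissible M i)"
  using M unfolding finite_mdp_def by (metis UN_upper finite_subset lessThan_iff)

lemma finite_policies: "finite (policies M)"
  unfolding policies_def by (intro finite_PiE) (auto simp: finite_admissible)

lemma policies_nonempty: "policies M \<noteq> {}"
  using M by (auto simp: policies_def PiE_eq_empty_iff finite_mdp_def)

lemma chain: "\<pi> \<in> policies M \<Longrightarrow> finite_chain n (chain \<pi>)"
  by unfold_locales (simp_all add: trans_nonneg trans_sum policy_admissible)

lemma backup_eq:
  "\<pi> \<in> policies M \<Longrightarrow> backup v i (\<pi> i) =
    (\<Sum>j<n. trans M i (\<pi> i) j * reward M i (\<pi> i) j) + \<gamma> * finite_chain.app n (chain \<pi>) v i"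
  by (simp add: backup_def finite_chain.app_def chain)

lemma T_pol_index:
  "\<lbrakk>v \<in> carrier_vec n; i < n\<rbrakk> \<Longrightarrow> T_pol M \<pi> v $ i = backup (($) v) i (\<pi> i)"
  by (simp add: T_pol_def r_vec_def P_mat_def backup_def scalar_prod_def atLeast0LessThan)

lemma T_pol_carrier: "T_pol M \<pi> v \<in> carrier_vec n"
  unfolding carrier_vec_def by (simp add: T_pol_def r_vec_def P_mat_def)

lemma val_fixed_point:
  assumes "\<pi> \<in> policies M"
  shows "val M \<pi> \<in> carrier_vec n \<and> T_pol M \<pi> (val M \<pi>) = val M \<pi>"
  unfolding val_def
proof (rule theI')
  interpret finite_chain n "chain \<pi>" using chain[OF assms] .
  define r where "r i = (\<Sum>j<n. trans M i (\<pi> i) j * reward M i (\<pi> i) j)" for i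
  have T: "T_pol M \<pi> v $ i = r i + \<gamma> * app (($) v) i" if "v \<in> carrier_vec n" "i < n" for v i
    using that by (simp add: T_pol_index backup_eq[OF assms] r_def)
  obtain z where z: "\<forall>j<n. z j = r j + \<gamma> * app z j"
    using discounted_exists[OF \<gamma>] by blast
  show "\<exists>!v. v \<in> carrier_vec n \<and> T_pol M \<pi> v = v"
  proof (intro ex1I[of _ "vec n z"] conjI; (elim conjE)?)
    show "T_pol M \<pi> (vec n z) = vec n z"
    proof (rule eq_vecI)
      fix i assume "i < dim_vec (vec n z)"
      then have i: "i < n" by simp
      have "app (($) (vec n z)) i = app z i" by (rule app_cong) simp
      then show "T_pol M \<pi> (vec n z) $ i = vec n z $ i" using T[of "vec n z" i] z i by simp
    qed (use T_pol_carrier[of \<pi> "vec n z"] in simp)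
  next
    fix v assume v: "v \<in> carrier_vec n" "T_pol M \<pi> v = v"
    show "v = vec n z"
    proof (rule eq_vecI)
      fix i assume "i < dim_vec (vec n z)"
      then have i: "i < n" by simp
      have "v $ i = z i"
        by (rule discounted_unique[OF \<gamma> _ _ i, of _ r]) (use T[OF v(1)] v(2) z in auto)
      then show "v $ i = vec n z $ i" using i by simp
    qed (use v in simp)
  qed simp
qed

lemma V_eq: "\<lbrakk>\<pi> \<in> policies M; i < n\<rbrakk> \<Longrightarrow> V \<pi> i = backup (V \<pi>) i (\<pi> i)"
  using val_fixed_point[of \<pi>] T_pol_index[of "val M \<pi>" i \<pi>] by simp

lemma adv_self: "\<lbrakk>\<pi> \<in> policies M; i < n\<rbrakk> \<Longrightarrow> adv \<pi> i (\<pi> i) = 0"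
  using V_eq by (simp add: adv_def)

lemma backup_mono:
  "\<lbrakk>i < n; a \<in> admissible M i; \<And>j. j < n \<Longrightarrow> u j \<le> v j\<rbrakk> \<Longrightarrow> backup u i a \<le> backup v i a"
  unfolding backup_def using \<gamma> trans_nonneg
  by (intro add_left_mono mult_left_mono sum_mono) auto

section \<open>Comparison of policies\<close>

text \<open>Inserting the backup of \<open>V \<pi>\<close> under the action of \<open>\<pi>'\<close>
  shows that the difference solves the discounted equation of the chain of \<open>\<pi>'\<close>
  with the advantages over \<open>\<pi>\<close> as source.\<close>

lemma V_difference:
  assumes "\<pi> \<in> policies M" "\<pi>' \<in> policies M" "i < n"
  shows "V \<pi>' i - V \<pi> i = adv \<pi> i (\<pi>' i) + \<gamma> * finite_chain.app n (chain \<pi>') (\<lambda>i. V \<pi>' i - V \<pi> i) i"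
  unfolding adv_def finite_chain.app_diff[OF chain[OF assms(2)]] V_eq[OF assms(2,3)] backup_eq[OF assms(2)]
  by (simp add: algebra_simps)

text \<open>The performance difference formula, obtained by applying \<open>sum_discounted\<close>
  to \<open>V_difference\<close>.\<close>

lemma total_difference:
  assumes "\<pi> \<in> policies M" "\<pi>' \<in> policies M"
  shows "total \<pi>' - total \<pi> = (\<Sum>i<n. occs \<pi>' i * adv \<pi> i (\<pi>' i))"
  using finite_chain.sum_discounted[OF chain[OF assms(2)] \<gamma> V_difference[OF assms]]
  by (simp add: total_def sum_subtractf)

lemma V_mono:
  assumes "\<pi> \<in> policies M" "\<pi>' \<in> policies M" "\<And>i. i < n \<Longrightarrow> 0 \<le> adv \<pi> i (\<pi>' i)" "i < n"
  shows "V \<pi> i \<le> V \<pi>' i"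
proof -
  have "0 \<le> V \<pi>' i - V \<pi> i"
    by (rule finite_chain.discounted_nonneg[OF chain[OF assms(2)] \<gamma> _ \<open>i < n\<close>])
       (use V_difference[OF assms(1,2)] assms(3) in fastforce)
  then show ?thesis by simp
qed

lemma V_antimono:
  assumes "\<pi> \<in> policies M" "\<pi>' \<in> policies M" "\<And>i. i < n \<Longrightarrow> adv \<pi> i (\<pi>' i) \<le> 0" "i < n"
  shows "V \<pi>' i \<le> V \<pi> i"
proof -
  interpret finite_chain n "chain \<pi>'" using chain[OF assms(2)] .
  have "0 \<le> V \<pi> i - V \<pi>' i"
  proof (rule discounted_nonneg[OF \<gamma> _ \<open>i < n\<close>])
    fix j assume "j < n"
    have "app (\<lambda>i. V \<pi> i - V \<pi>' i) j = - app (\<lambda>i. V \<pi>' i - V \<pi> i) j" by (simp add: app_diff)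
    then show "\<gamma> * app (\<lambda>i. V \<pi> i - V \<pi>' i) j \<le> V \<pi> j - V \<pi>' j"
      using V_difference[OF assms(1,2) \<open>j < n\<close>] assms(3)[OF \<open>j < n\<close>] by simp
  qed
  then show ?thesis by simp
qed

lemma occs_ge_1: "\<lbrakk>\<pi> \<in> policies M; i < n\<rbrakk> \<Longrightarrow> 1 \<le> occs \<pi> i"
  using finite_chain.occ_ge_1[OF chain \<gamma>] .

lemma occs_le:
  assumes "\<pi> \<in> policies M" "i < n" shows "occs \<pi> i \<le> real n / (1 - \<gamma>)"
proof -
  have "occs \<pi> i \<le> (\<Sum>i<n. occs \<pi> i)"
    using occs_ge_1[OF assms(1)] assms(2) by (intro member_le_sum) (auto intro: order_trans[of 0 1])
  then show ?thesis using finite_chain.sum_occ[OF chain[OF assms(1)] \<gamma>] by simp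
qed

text \<open>A maximizer of \<open>total\<close> over the finitely many policies works: adopting an
  action of positive advantage at one state would raise \<open>total\<close>, as occupancies are at
  least 1.\<close>

lemma ex_dominating_policy:
  obtains \<pi> where "\<pi> \<in> policies M" "\<And>i a. \<lbrakk>i < n; a \<in> admissible M i\<rbrakk> \<Longrightarrow> adv \<pi> i a \<le> 0"
proof -
  have "Max (total ` policies M) \<in> total ` policies M"
    using finite_policies policies_nonempty by (intro Max_in) auto
  then obtain \<pi> where "\<pi> \<in> policies M" "total \<pi> = Max (total ` policies M)" by auto
  then have \<pi>: "\<pi> \<in> policies M" "\<And>\<pi>'. \<pi>' \<in> policies M \<Longrightarrow> total \<pi>' \<le> total \<pi>"
    using finite_policies by auto
  have "adv \<pi> i a \<le> 0" if "i < n" "a \<in> admissible M i" for i a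
  proof (rule ccontr)
    assume "\<not> adv \<pi> i a \<le> 0"
    let ?\<pi>' = "\<pi>(i := a)"
    have \<pi>': "?\<pi>' \<in> policies M" using policy_update \<pi>(1) that by blast
    have "total ?\<pi>' - total \<pi> = (\<Sum>j<n. occs ?\<pi>' j * adv \<pi> j (?\<pi>' j))"
      using total_difference[OF \<pi>(1) \<pi>'] .
    also have "\<dots> = (\<Sum>j<n. if j = i then occs ?\<pi>' i * adv \<pi> i a else 0)"
      using adv_self[OF \<pi>(1)] by (intro sum.cong) auto
    also have "\<dots> = occs ?\<pi>' i * adv \<pi> i a" using that by simp
    also have "\<dots> > 0"
      using occs_ge_1[OF \<pi>' that(1)] \<open>\<not> adv \<pi> i a \<le> 0\<close> by (intro mult_pos_pos) auto
    finally show False using \<pi>(2)[OF \<pi>'] by simp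
  qed
  then show thesis using that \<pi>(1) by blast
qed

lemma T_opt_ge:
  assumes "v \<in> carrier_vec n" "i < n" "a \<in> admissible M i"
  shows "backup (($) v) i a \<le> T_opt M v $ i"
proof -
  obtain \<pi> where \<pi>: "\<pi> \<in> policies M" using policies_nonempty by blast
  have "backup (($) v) i a = T_pol M (\<pi>(i := a)) v $ i" using T_pol_index[OF assms(1,2)] by simp
  also have "\<dots> \<le> T_opt M v $ i"
    using finite_policies policy_update[OF \<pi> assms(2,3)] assms(2) by (simp add: T_opt_def)
  finally show ?thesis .
qed

lemma optimal_if_no_advantage:
  assumes "\<pi> \<in> policies M" "\<And>i a. \<lbrakk>i < n; a \<in> admissible M i\<rbrakk> \<Longrightarrow> adv \<pi> i a \<le> 0"
  shows "optimal M \<pi>"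
proof -
  have "val M \<pi> = opt_val M"
  proof (rule eq_vecI)
    fix i assume "i < dim_vec (opt_val M)"
    then have i: "i < n" by (simp add: opt_val_def)
    have "Max ((\<lambda>\<pi>. V \<pi> i) ` policies M) = V \<pi> i"
    proof (rule Max_eqI)
      fix y assume "y \<in> (\<lambda>\<pi>. V \<pi> i) ` policies M"
      then obtain \<pi>' where \<pi>': "\<pi>' \<in> policies M" "y = V \<pi>' i" by blast
      show "y \<le> V \<pi> i"
        unfolding \<pi>'(2) by (rule V_antimono[OF assms(1) \<pi>'(1) assms(2) i]) (use \<pi>' policy_admissible in auto)
    qed (use finite_policies assms(1) in auto)
    then show "V \<pi> i = opt_val M $ i" using i by (simp add: opt_val_def)
  qed (use val_fixed_point[OF assms(1)] in \<open>simp add: opt_val_def\<close>)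
  then show ?thesis using assms(1) by (simp add: optimal_def)
qed

section \<open>Iterations of Simplex-PI\<close>

text \<open>What the counting uses of an iteration from a policy that is not optimal: the greedy
  choice of the action and the choice of the state merge into one maximum over pairs.\<close>

definition switches :: "(nat \<Rightarrow> 'a) \<Rightarrow> nat \<Rightarrow> (nat \<Rightarrow> 'a) \<Rightarrow> bool" where
  "switches \<pi> i \<pi>' \<longleftrightarrow> \<pi> \<in> policies M \<and> \<pi>' \<in> policies M \<and> i < n \<and> (\<forall>j. j \<noteq> i \<longrightarrow> \<pi>' j = \<pi> j) \<and>
     (\<forall>j<n. \<forall>b\<in>admissible M j. adv \<pi> j b \<le> adv \<pi> i (\<pi>' i)) \<and> 0 < adv \<pi> i (\<pi>' i)"

text \<open>A greedy policy attains the maximal advantage at every state. If the largest of these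
  were not positive, \<open>optimal_if_no_advantage\<close> would apply.\<close>

lemma simplex_pi_step_switches:
  assumes "simplex_pi_step M \<pi> \<pi>'" "\<pi> \<in> policies M" "\<not> optimal M \<pi>"
  obtains i where "switches \<pi> i \<pi>'"
proof -
  obtain g i where g: "greedy M (val M \<pi>) g" and i: "i < n"
    and max: "\<And>j. j < n \<Longrightarrow> advantage M \<pi> $ j \<le> advantage M \<pi> $ i"
    and \<pi>': "\<pi>' = switch \<pi> g {i}"
    using assms(1) unfolding simplex_pi_step_def is_arg_max_def by (metis not_less)
  have carrier: "val M \<pi> \<in> carrier_vec n" using val_fixed_point[OF assms(2)] by blast
  have gpol: "g \<in> policies M" using g by (simp add: greedy_def)
  have adv: "advantage M \<pi> $ j = adv \<pi> j (g j)" "\<And>b. b \<in> admissible M j \<Longrightarrow> adv \<pi> j b \<le> adv \<pi> j (g j)"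
    if "j < n" for j
  proof -
    have T: "T_opt M (val M \<pi>) $ j = backup (V \<pi>) j (g j)"
      using g T_pol_index[OF carrier that, of g] by (simp add: greedy_def)
    show "advantage M \<pi> $ j = adv \<pi> j (g j)"
      using T carrier that by (simp add: advantage_def adv_def)
    show "adv \<pi> j b \<le> adv \<pi> j (g j)" if "b \<in> admissible M j" for b
      using T_opt_ge[OF carrier \<open>j < n\<close> that] T by (simp add: adv_def)
  qed
  have "\<pi>' i = g i" by (simp add: \<pi>' switch_def)
  have *: "adv \<pi> j b \<le> adv \<pi> i (g i)" if "j < n" "b \<in> admissible M j" for j b
    using adv[OF that(1)] adv(1)[OF i] max[OF that(1)] that(2) by fastforce
  have "0 < adv \<pi> i (g i)"
  proof (rule ccontr)
    assume "\<not> 0 < adv \<pi> i (g i)"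
    then have "optimal M \<pi>"
      using * by (intro optimal_if_no_advantage assms) (meson not_less order_trans)
    then show False using assms(3) by blast
  qed
  moreover have "\<pi>' = \<pi>(i := g i)" by (auto simp: \<pi>' switch_def)
  ultimately have "switches \<pi> i \<pi>'"
    using * policy_update[OF assms(2) i policy_admissible[OF gpol i]] assms(2) i
    by (simp add: switches_def)
  then show thesis using that by blast
qed

lemma switches_total:
  assumes "switches \<pi> i \<pi>'" shows "total \<pi>' - total \<pi> = occs \<pi>' i * adv \<pi> i (\<pi>' i)"
proof -
  have "total \<pi>' - total \<pi> = (\<Sum>j<n. occs \<pi>' j * adv \<pi> j (\<pi>' j))"
    using total_difference assms by (simp add: switches_def)
  also have "\<dots> = (\<Sum>j<n. if j = i then occs \<pi>' i * adv \<pi> i (\<pi>' i) else 0)"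
    using adv_self assms by (intro sum.cong) (auto simp: switches_def)
  also have "\<dots> = occs \<pi>' i * adv \<pi> i (\<pi>' i)" using assms by (simp add: switches_def)
  finally show ?thesis .
qed

lemma switches_V_mono:
  assumes "switches \<pi> i \<pi>'" "j < n" shows "V \<pi> j \<le> V \<pi>' j"
proof (rule V_mono)
  fix k assume "k < n"
  then show "0 \<le> adv \<pi> k (\<pi>' k)"
    using assms(1) adv_self by (cases "k = i") (auto simp: switches_def)
qed (use assms in \<open>auto simp: switches_def\<close>)

lemma switches_recs:
  assumes "switches \<pi> i \<pi>'" "i \<notin> recs \<pi>'" shows "recs \<pi>' \<subseteq> recs \<pi>"
  by (rule rec_subset_if_rows_agree[OF _ _ _ assms(2)])
     (use assms(1) chain in \<open>auto simp: switches_def\<close>)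

subsection \<open>The structural constants\<close>

lemma P_mat_index: "\<lbrakk>j < n; l < n\<rbrakk> \<Longrightarrow> P_mat M \<pi> $$ (j, l) = chain \<pi> j l"
  by (simp add: P_mat_def)

lemma return_prob_eq:
  assumes "\<pi> \<in> policies M" "i < n"
  shows "return_prob M \<pi> i = finite_chain.hitlim n (chain \<pi>) i i"
  unfolding return_prob_def
  by (rule finite_chain.lim_path_prob_return[OF chain[OF assms(1)] P_mat_index assms(2)])

lemma recurrent_if_recs: "\<lbrakk>\<pi> \<in> policies M; i \<in> recs \<pi>\<rbrakk> \<Longrightarrow> recurrent M \<pi> i"
  using return_prob_eq finite_chain.hitlim_rec[OF chain] finite_chain.rec_less[OF chain]
  by (simp add: recurrent_def)

lemma transient_if_not_recs: "\<lbrakk>\<pi> \<in> policies M; i < n; i \<notin> recs \<pi>\<rbrakk> \<Longrightarrow> transient M \<pi> i"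
  using return_prob_eq finite_chain.hitlim_not_rec[OF chain] by (simp add: transient_def)

lemma tau_eq:
  assumes "\<pi> \<in> policies M"
  shows "tau M \<pi> i t = (\<Sum>j<n. finite_chain.visits n (chain \<pi>) i t j) / real n"
  unfolding tau_def by (rule finite_chain.sum_path_prob_uniform[OF chain[OF assms] P_mat_index])

text \<open>Only finitely many policies and states occur, so the least bound exists and is a
  maximum. Inserting 0 accounts for the nonnegativity clause of \<open>tau_t\<close>.\<close>

lemma lim_tau_le_tau_t:
  assumes "\<pi> \<in> policies M" "i < n" "transient M \<pi> i"
  shows "lim (tau M \<pi> i) \<le> tau_t M"
proof -
  let ?S = "insert 0 ((\<lambda>(\<pi>, i). lim (tau M \<pi> i)) ` {(\<pi>, i) \<in> policies M \<times> {..<n}. transient M \<pi> i})"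
  have fin: "finite ?S"
    by (intro finite.insertI finite_imageI finite_subset[OF _ finite_cartesian_product[OF finite_policies finite_lessThan[of n]]]) auto
  have "tau_t M = Max ?S"
    unfolding tau_t_def
  proof (rule Least_equality)
    show "0 \<le> Max ?S \<and> (\<forall>\<pi>\<in>policies M. \<forall>i<n. transient M \<pi> i \<longrightarrow> lim (tau M \<pi> i) \<le> Max ?S)"
      using fin by (auto intro!: Max_ge)
  qed (use fin in \<open>auto intro!: Max.boundedI\<close>)
  then show ?thesis using assms fin by (auto intro!: Max_ge)
qed

lemma inverse_mu_le_tau_r:
  assumes "\<pi> \<in> policies M" "i < n" "recurrent M \<pi> i"
  shows "1 / mu M \<pi> i \<le> tau_r M"
proof -
  let ?S = "(\<lambda>(\<pi>, i). 1 / mu M \<pi> i) ` {(\<pi>, i) \<in> policies M \<times> {..<n}. recurrent M \<pi> i}"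
  have fin: "finite ?S"
    by (intro finite_imageI finite_subset[OF _ finite_cartesian_product[OF finite_policies finite_lessThan[of n]]]) auto
  have ne: "?S \<noteq> {}" using assms by auto
  have "tau_r M = Max ?S"
    unfolding tau_r_def
  proof (rule Least_equality)
    show "\<forall>\<pi>\<in>policies M. \<forall>i<n. recurrent M \<pi> i \<longrightarrow> 1 / mu M \<pi> i \<le> Max ?S"
      using fin by (auto intro!: Max_ge)
  qed (use fin ne in \<open>auto intro!: Max.boundedI\<close>)
  then show ?thesis using assms fin by (auto intro!: Max_ge)
qed

lemma occs_transient_bound:
  assumes "\<pi> \<in> policies M" "i < n" "i \<notin> recs \<pi>"
  shows "occs \<pi> i \<le> real n * tau_t M"
proof -
  have "occs \<pi> i \<le> real n * lim (tau M \<pi> i)"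
    using finite_chain.occ_transient[OF chain[OF assms(1)] \<gamma> assms(2,3)]
    by (simp add: tau_eq[OF assms(1), abs_def])
  also have "\<dots> \<le> real n * tau_t M"
    using lim_tau_le_tau_t[OF assms(1,2)] transient_if_not_recs[OF assms] by (simp add: mult_left_mono)
  finally show ?thesis .
qed

text \<open>The long-run frequency of \<open>i\<close> is at least \<open>1 / tau_r M\<close> and at
  most \<open>(1 - \<gamma>) * occs \<pi> i\<close>.\<close>

lemma occs_recurrent_bound:
  assumes "\<pi> \<in> policies M" "i \<in> recs \<pi>"
  shows "1 \<le> (1 - \<gamma>) * occs \<pi> i * tau_r M"
proof -
  have i: "i < n" using finite_chain.rec_less[OF chain] assms by blast
  obtain \<mu> where lim: "(\<lambda>t. 1 / real t * tau M \<pi> i t) \<longlonglongrightarrow> \<mu>"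
    and \<mu>: "0 < \<mu>" "\<mu> \<le> (1 - \<gamma>) * occs \<pi> i"
    using finite_chain.occ_recurrent[OF chain[OF assms(1)] \<gamma> assms(2)] by (auto simp: tau_eq[OF assms(1)])
  have "mu M \<pi> i = \<mu>" unfolding mu_def using lim by (rule limI)
  then have le: "1 / \<mu> \<le> tau_r M"
    using inverse_mu_le_tau_r[OF assms(1) i recurrent_if_recs[OF assms]] by simp
  have "1 \<le> \<mu> * tau_r M" using le \<mu>(1) by (simp add: pos_divide_le_eq mult.commute)
  also have "\<dots> \<le> (1 - \<gamma>) * occs \<pi> i * tau_r M"
    using le \<mu> by (intro mult_right_mono) (auto intro: order_trans[of 0 "1 / \<mu>"])
  finally show ?thesis .
qed

end

section \<open>Elimination and contraction estimates\<close>

text \<open>Pigeonhole: the elements chosen at times 0, \<open>N\<close>, \<open>2 * N\<close> and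
  so on are distinct, since each is absent from the next of these times up to
  \<open>K\<close>.\<close>

lemma elimination_bound:
  fixes act :: "nat \<Rightarrow> 'b set"
  assumes "finite U" "0 < N"
    and ex: "\<And>k. k \<le> K \<Longrightarrow> \<exists>u\<in>U. u \<in> act k \<and> (\<forall>l. k + N \<le> l \<and> l \<le> K \<longrightarrow> u \<notin> act l)"
  shows "K < card U * N"
proof (rule ccontr)
  assume "\<not> K < card U * N"
  then have le: "j * N \<le> K" if "j \<le> card U" for j
    using that by (meson le_trans mult_le_mono1 not_less)
  have "\<forall>j\<in>{..card U}. \<exists>u. u \<in> U \<and> u \<in> act (j * N) \<and> (\<forall>l. j * N + N \<le> l \<and> l \<le> K \<longrightarrow> u \<notin> act l)"
    using ex[OF le] by blast
  then obtain f where f: "\<And>j. j \<le> card U \<Longrightarrow> f j \<in> U \<and> f j \<in> act (j * N) \<and>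
      (\<forall>l. j * N + N \<le> l \<and> l \<le> K \<longrightarrow> f j \<notin> act l)"
    unfolding bchoice_iff by (auto simp: Ball_def)
  have ne: "f a \<noteq> f b" if "a < b" "b \<le> card U" for a b
  proof -
    have "a * N + N \<le> b * N" using mult_le_mono1[of "Suc a" b N] that by simp
    then have "f a \<notin> act (b * N)" using f[of a] le[of b] that by simp
    then show ?thesis using f[of b] that by auto
  qed
  have "inj_on f {..card U}"
    by (rule linorder_inj_onI) (use ne in auto)
  then have "card {..card U} \<le> card U"
    using f \<open>finite U\<close> by (intro card_inj_on_le[of f]) auto
  then show False by simp
qed

text \<open>Bernoulli's inequality replaces logarithms: \<open>(1 + 1 / c) ^ N\<close> is at least
  \<open>1 + d\<close>, and its product with \<open>(1 - 1 / c) ^ N\<close> is at most 1.\<close>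

lemma contraction_power:
  fixes c d :: real
  assumes "1 \<le> c" "0 \<le> d" "c * d \<le> real N"
  shows "(1 - 1 / c) ^ N * d < 1"
proof -
  have "d \<le> real N / c" using assms by (simp add: field_simps)
  then have "1 + d \<le> (1 + 1 / c) ^ N"
    using Bernoulli_inequality[of "1 / c" N] order_trans[of "-1" 0 "1 / c"] assms(1) by auto
  moreover have "0 \<le> (1 - 1 / c) ^ N" using assms by simp
  ultimately have "(1 - 1 / c) ^ N * (1 + d) \<le> (1 - 1 / c) ^ N * (1 + 1 / c) ^ N"
    by (intro mult_left_mono)
  also have "\<dots> = (1 - (1 / c)\<^sup>2) ^ N"
    by (simp add: power_mult_distrib[symmetric] power2_eq_square algebra_simps)
  also have "\<dots> \<le> 1"
    using assms by (intro power_le_one) (auto simp: power_le_one)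
  finally have le: "(1 - 1 / c) ^ N * (1 + d) \<le> 1" .
  show ?thesis
  \<comment> \<open>The power can be 0 when \<open>c = 1\<close>; otherwise it is positive, and
    subtracting it from both sides of \<open>le\<close> gives strictness.\<close>
  proof (cases "(1 - 1 / c) ^ N = 0")
    case True
    then show ?thesis by (simp only: mult_zero_left zero_less_one)
  next
    case False
    then have "0 < (1 - 1 / c) ^ N"
      using \<open>0 \<le> (1 - 1 / c) ^ N\<close> order_le_neq_trans[of 0 "(1 - 1 / c) ^ N"] by metis
    then show ?thesis using le by (simp add: distrib_left)
  qed
qed

lemma contraction_steps:
  fixes s :: "nat \<Rightarrow> real"
  assumes "\<And>k. k + B \<le> K \<Longrightarrow> s (k + B) \<le> q * s k" "0 \<le> q" "a + j * B \<le> K"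
  shows "s (a + j * B) \<le> q ^ j * s a"
  using assms(3)
proof (induction j)
  case (Suc j)
  have "s (a + Suc j * B) \<le> q * s (a + j * B)"
    using assms(1)[of "a + j * B"] Suc.prems by (simp add: algebra_simps)
  also have "\<dots> \<le> q * (q ^ j * s a)"
    using Suc.prems assms(2) by (intro mult_left_mono Suc.IH) auto
  finally show ?case by (simp add: algebra_simps)
qed simp

section \<open>Counting steps under occupancy bounds\<close>

text \<open>\<open>T\<close> and \<open>R\<close> stand for upper bounds of \<open>tau_t\<close> and
  \<open>tau_r\<close>, taken at least 1 so that the contraction factors lie between 0 and
  1.\<close>

locale bounded_mdp = fin_mdp M for M :: "'a mdp" +
  fixes T R :: real
  assumes T: "1 \<le> T" and R: "1 \<le> R"
    and occs_T: "\<lbrakk>\<pi> \<in> policies M; i < n; i \<notin> recs \<pi>\<rbrakk> \<Longrightarrow> occs \<pi> i \<le> real n * T"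
    and occs_R: "\<lbrakk>\<pi> \<in> policies M; i \<in> recs \<pi>\<rbrakk> \<Longrightarrow> 1 \<le> (1 - \<gamma>) * occs \<pi> i * R"
begin

definition pairs :: "(nat \<times> 'a) set" where
  "pairs = (SIGMA i:{..<n}. admissible M i)"

lemma finite_pairs: "finite pairs"
  unfolding pairs_def using finite_admissible by auto

lemma card_pairs: "card pairs = card (actions M)"
proof -
  have "card (\<Union>i<n. admissible M i) = (\<Sum>i<n. card (admissible M i))"
    using M finite_admissible by (intro card_UN_disjoint') (auto simp: finite_mdp_def)
  then show ?thesis
    using M finite_admissible by (simp add: pairs_def finite_mdp_def)
qed

lemma recs_less: "\<lbrakk>\<pi> \<in> policies M; i \<in> recs \<pi>\<rbrakk> \<Longrightarrow> i < n"
  using finite_chain.rec_less[OF chain] by blast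

lemma switches_total_ge:
  assumes "switches \<pi> i \<pi>'" shows "adv \<pi> i (\<pi>' i) \<le> total \<pi>' - total \<pi>"
proof -
  have "1 * adv \<pi> i (\<pi>' i) \<le> occs \<pi>' i * adv \<pi> i (\<pi>' i)"
    using assms occs_ge_1[of \<pi>' i] by (intro mult_right_mono) (auto simp: switches_def)
  then show ?thesis using switches_total[OF assms] by simp
qed

lemma total_less: "switches \<pi> i \<pi>' \<Longrightarrow> total \<pi> < total \<pi>'"
  using switches_total_ge[of \<pi> i \<pi>'] by (simp add: switches_def)

(* The loss of an action against the value of e bounds the gap of every policy that still uses it. *)
lemma total_gap_ge:
  assumes "e \<in> policies M" "\<pi> \<in> policies M" "i < n" and le: "\<And>j. j < n \<Longrightarrow> V \<pi> j \<le> V e j"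
  shows "- adv e i (\<pi> i) \<le> total e - total \<pi>"
proof -
  have "V \<pi> i = backup (V \<pi>) i (\<pi> i)" using V_eq assms by blast
  also have "\<dots> \<le> backup (V e) i (\<pi> i)"
    by (rule backup_mono) (use assms policy_admissible in auto)
  finally have "- adv e i (\<pi> i) \<le> V e i - V \<pi> i" by (simp add: adv_def)
  also have "\<dots> \<le> (\<Sum>j<n. V e j - V \<pi> j)"
    using le \<open>i < n\<close> by (intro member_le_sum) auto
  finally show ?thesis by (simp add: total_def sum_subtractf)
qed

section \<open>Runs that switch only transient states\<close>

context
  fixes \<sigma> :: "nat \<Rightarrow> nat \<Rightarrow> 'a" and st :: "nat \<Rightarrow> nat" and K :: nat
  assumes sw: "\<And>k. k < K \<Longrightarrow> switches (\<sigma> k) (st k) (\<sigma> (Suc k))"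
    and \<sigma>0: "\<sigma> 0 \<in> policies M"
begin

lemma run_policies: "k \<le> K \<Longrightarrow> \<sigma> k \<in> policies M"
  using sw[of "k - 1"] \<sigma>0 by (cases k) (auto simp: switches_def)

lemma run_V_mono:
  assumes "k \<le> l" "l \<le> K" "j < n" shows "V (\<sigma> k) j \<le> V (\<sigma> l) j"
  using assms
proof (induction l rule: dec_induct)
  case (step l)
  then show ?case using switches_V_mono[OF sw, of l j] by simp
qed simp

lemma run_total_mono: "\<lbrakk>k \<le> l; l \<le> K\<rbrakk> \<Longrightarrow> total (\<sigma> k) \<le> total (\<sigma> l)"
  unfolding total_def by (intro sum_mono run_V_mono) auto

text \<open>All policies of the stretch agree on the fixed recurrent set, so only transient states,
  whose occupancies are at most \<open>n * T\<close>, contribute to the gap to the last policy. That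
  gap shrinks geometrically, which eliminates state-action pairs.\<close>

lemma transient_stretch_bound:
  assumes trans: "\<And>k. k < K \<Longrightarrow> st k \<notin> recs (\<sigma> (Suc k))"
    and const: "\<And>k. k \<le> K \<Longrightarrow> recs (\<sigma> k) = recs (\<sigma> 0)"
    and N: "(real n ^ 2 * T) * (real n ^ 2 * T) \<le> real N"
  shows "K < card (actions M) * N"
proof -
  \<comment> \<open>\<open>?c\<close> accounts for \<open>n\<close> terms, each weighted by an
    occupancy of at most \<open>n * T\<close>.\<close>
  let ?e = "\<sigma> K" and ?R = "recs (\<sigma> 0)" and ?c = "real n ^ 2 * T"
  have e: "?e \<in> policies M" using run_policies by simp
  have n1: "1 \<le> real n" using n_pos by simp
  have c1: "1 \<le> ?c" using n1 T by (metis one_le_power mult_mono' mult_1 zero_le_one)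
  \<comment> \<open>Backwards from the end: a switched state lies outside the recurrent set of the
    new policy, which is \<open>?R\<close>.\<close>
  have agree: "\<sigma> k j = ?e j" if "k \<le> K" "j \<in> ?R" for k j
    using that(1)
  proof (induction k rule: inc_induct)
    case (step k)
    then have "j \<noteq> st k" using trans const[of "Suc k"] that(2) by auto
    then show ?case using sw[of k] step by (auto simp: switches_def)
  qed simp
  define D where "D k = total ?e - total (\<sigma> k)" for k
  have D_pos: "0 < D k" if "k < K" for k
    using total_less[OF sw[OF that]] run_total_mono[of "Suc k" K] that by (simp add: D_def)
  have D_anti: "D l \<le> D k" if "k \<le> l" "l \<le> K" for k l
    using run_total_mono[OF that] by (simp add: D_def)
  have bound: "(\<Sum>i<n. occs \<pi> i * x i) \<le> ?c * b"
    if "\<pi> \<in> policies M" "recs \<pi> = ?R" "0 \<le> b" "\<And>i. i < n \<Longrightarrow> x i \<le> b" "\<And>i. i \<in> ?R \<Longrightarrow> x i = 0" for \<pi> x b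
  proof -
    have "(\<Sum>i<n. occs \<pi> i * x i) \<le> (\<Sum>i<n. real n * T * b)"
    proof (rule sum_mono)
      fix i assume i: "i \<in> {..<n}"
      show "occs \<pi> i * x i \<le> real n * T * b"
      proof (cases "i \<in> ?R")
        case False
        have "0 \<le> occs \<pi> i" using occs_ge_1[OF that(1), of i] i by simp
        then have "occs \<pi> i * x i \<le> occs \<pi> i * b" using that(4) i by (intro mult_left_mono) auto
        also have "\<dots> \<le> real n * T * b"
          using occs_T[OF that(1)] False i that by (intro mult_right_mono) auto
        finally show ?thesis .
      qed (use that T in simp)
    qed
    then show ?thesis by (simp add: power2_eq_square)
  qed
  have contract: "D (Suc k) \<le> (1 - 1 / ?c) * D k" if "k < K" for k
  proof -
    have \<sigma>k: "\<sigma> k \<in> policies M" using run_policies that by simp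
    let ?\<Delta> = "adv (\<sigma> k) (st k) (\<sigma> (Suc k) (st k))"
    have "D k = (\<Sum>i<n. occs ?e i * adv (\<sigma> k) i (?e i))"
      unfolding D_def by (rule total_difference[OF \<sigma>k e])
    also have "\<dots> \<le> ?c * ?\<Delta>"
    proof (rule bound[OF e])
      show "0 \<le> ?\<Delta>" using sw[OF \<open>k < K\<close>] by (simp add: switches_def)
      show "adv (\<sigma> k) i (?e i) \<le> ?\<Delta>" if "i < n" for i
        using sw[OF \<open>k < K\<close>] policy_admissible[OF e] that by (auto simp: switches_def)
      show "adv (\<sigma> k) i (?e i) = 0" if "i \<in> ?R" for i
        using adv_self[OF \<sigma>k, of i] agree[of k i] recs_less[OF \<sigma>0 that] \<open>k < K\<close> that by simp
    qed (rule const, simp)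
    also have "\<dots> \<le> ?c * (D k - D (Suc k))"
      using switches_total_ge[OF sw[OF that]] c1 by (intro mult_left_mono) (auto simp: D_def)
    finally have "D k / ?c \<le> D k - D (Suc k)" using c1 by (simp add: pos_divide_le_eq mult.commute)
    then show ?thesis by (simp add: left_diff_distrib)
  qed
  \<comment> \<open>\<open>N\<close> is large enough for \<open>contraction_power\<close> with
    \<open>d\<close> equal to \<open>?c\<close>.\<close>
  have gap: "D (k + N) * ?c < D k" if "k + N \<le> K" "k < K" for k
  proof -
    have "D (k + N * 1) \<le> (1 - 1 / ?c) ^ N * D k"
      by (rule contraction_steps[where K = K]) (use contract c1 that in auto)
    then have "D (k + N) * ?c \<le> ((1 - 1 / ?c) ^ N * ?c) * D k"
      using c1 mult_right_mono[of "D (k + N)" "(1 - 1 / ?c) ^ N * D k" ?c] by (simp add: mult_ac)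
    also have "\<dots> < 1 * D k"
      using contraction_power[OF c1 _ N] c1 D_pos[OF that(2)] by (intro mult_strict_right_mono) auto
    finally show ?thesis by simp
  qed
  have "K < card pairs * N"
  proof (rule elimination_bound[where act = "\<lambda>k. (\<lambda>i. (i, \<sigma> k i)) ` {..<n}"])
    have "0 < ?c * ?c" using c1 by simp
    then show "0 < N" using N by linarith
    fix k assume k: "k \<le> K"
    then have \<sigma>k: "\<sigma> k \<in> policies M" using run_policies by simp
    show "\<exists>u\<in>pairs. u \<in> (\<lambda>i. (i, \<sigma> k i)) ` {..<n} \<and>
        (\<forall>l. k + N \<le> l \<and> l \<le> K \<longrightarrow> u \<notin> (\<lambda>i. (i, \<sigma> l i)) ` {..<n})"
    proof (cases "k = K")
      case True
      then show ?thesis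
        using n_pos \<open>0 < N\<close> policy_admissible[OF \<sigma>k n_pos] by (intro bexI[of _ "(0, \<sigma> k 0)"]) (auto simp: pairs_def)
    next
      case False
      then have "k < K" using k by simp
      have "\<exists>i<n. D k \<le> ?c * (- adv ?e i (\<sigma> k i))"
      proof (rule ccontr)
        assume "\<not> ?thesis"
        then have lt: "?c * (- adv ?e i (\<sigma> k i)) < D k" if "i < n" for i using that by auto
        \<comment> \<open>The last policy need not be optimal, so the losses against it can be
          negative; inserting 0 supplies the nonnegative bound that \<open>bound\<close> asks
          for.\<close>
        define b where "b = Max (insert 0 ((\<lambda>i. - adv ?e i (\<sigma> k i)) ` {..<n}))"
        have "?c * b < D k"
        proof -
          have "b \<in> insert 0 ((\<lambda>i. - adv ?e i (\<sigma> k i)) ` {..<n})"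
            unfolding b_def by (intro Max_in) auto
          then show ?thesis using lt D_pos[OF \<open>k < K\<close>] by auto
        qed
        have "- (total (\<sigma> k) - total ?e) = (\<Sum>i<n. occs (\<sigma> k) i * (- adv ?e i (\<sigma> k i)))"
          unfolding total_difference[OF e \<sigma>k] by (simp add: sum_negf)
        also have "\<dots> \<le> ?c * b"
        proof (rule bound[OF \<sigma>k])
          show "0 \<le> b" by (simp add: b_def)
          show "- adv ?e i (\<sigma> k i) \<le> b" if "i < n" for i using that by (auto simp: b_def intro!: Max_ge)
          show "- adv ?e i (\<sigma> k i) = 0" if "i \<in> ?R" for i
            using adv_self[OF e] agree[of k i] recs_less[OF \<sigma>0] \<open>k < K\<close> that by simp
        qed (rule const, rule k)
        finally show False using \<open>?c * b < D k\<close> by (simp add: D_def)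
      qed
      then obtain i where i: "i < n" "D k \<le> ?c * (- adv ?e i (\<sigma> k i))" by blast
      \<comment> \<open>Reusing this action would force a gap of at least \<open>D k / ?c\<close>,
        more than is left after \<open>N\<close> steps.\<close>
      have "(i, \<sigma> k i) \<notin> (\<lambda>i. (i, \<sigma> l i)) ` {..<n}" if l: "k + N \<le> l" "l \<le> K" for l
      proof
        assume "(i, \<sigma> k i) \<in> (\<lambda>i. (i, \<sigma> l i)) ` {..<n}"
        then have same: "\<sigma> l i = \<sigma> k i" by auto
        have "- adv ?e i (\<sigma> l i) \<le> D l"
          unfolding D_def using l i run_policies run_V_mono by (intro total_gap_ge) auto
        also have "\<dots> \<le> D (k + N)" using D_anti[OF l] .
        finally have "- adv ?e i (\<sigma> k i) \<le> D (k + N)" using same by simp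
        then have "?c * (- adv ?e i (\<sigma> k i)) \<le> ?c * D (k + N)"
          using c1 by (intro mult_left_mono) auto
        then show False using gap[of k] i(2) l \<open>k < K\<close> by (simp add: mult.commute)
      qed
      moreover have "(i, \<sigma> k i) \<in> pairs" "(i, \<sigma> k i) \<in> (\<lambda>i. (i, \<sigma> k i)) ` {..<n}"
        using i(1) policy_admissible[OF \<sigma>k i(1)] by (auto simp: pairs_def)
      ultimately show ?thesis by blast
    qed
  qed (rule finite_pairs)
  then show ?thesis by (simp add: card_pairs)
qed

end

text \<open>The recurrent sets decrease along such a run. By \<open>transient_stretch_bound\<close>
  each block of \<open>card (actions M) * N\<close> steps loses a recurrent state, and
  \<open>n + 1\<close> blocks would lose more than \<open>n\<close> of them.\<close>

lemma transient_run_bound: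
  assumes sw: "\<And>k. k < K \<Longrightarrow> switches (\<sigma> k) (st k) (\<sigma> (Suc k))"
    and \<sigma>0: "\<sigma> 0 \<in> policies M"
    and trans: "\<And>k. k < K \<Longrightarrow> st k \<notin> recs (\<sigma> (Suc k))"
    and N: "(real n ^ 2 * T) * (real n ^ 2 * T) \<le> real N"
  shows "K < (n + 1) * (card (actions M) * N)"
proof (rule ccontr)
  let ?W = "card (actions M) * N"
  assume "\<not> K < (n + 1) * ?W"
  then have K: "(n + 1) * ?W \<le> K" by simp
  have anti: "recs (\<sigma> l) \<subseteq> recs (\<sigma> k)" if "k \<le> l" "l \<le> K" for k l
    using that
  proof (induction l rule: dec_induct)
    case (step l)
    then show ?case using switches_recs[OF sw trans, of l] by auto
  qed simp
  have pol: "\<sigma> k \<in> policies M" if "k \<le> K" for k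
    using run_policies[OF sw \<sigma>0 that] .
  have fin: "finite (recs (\<sigma> k))" if "k \<le> K" for k
    using recs_less[OF pol[OF that]] by (auto intro: finite_subset[of _ "{..<n}"])
  have "card (recs (\<sigma> (j * ?W))) + j \<le> n" if "j \<le> n + 1" for j
    using that
  proof (induction j)
    case 0
    have "recs (\<sigma> 0) \<subseteq> {..<n}" using recs_less[OF \<sigma>0] by blast
    then show ?case using card_mono[of "{..<n}" "recs (\<sigma> 0)"] by simp
  next
    case (Suc j)
    have "j * ?W + ?W = Suc j * ?W" by simp
    also have "\<dots> \<le> (n + 1) * ?W" using Suc.prems by (intro mult_le_mono1)
    also have "\<dots> \<le> K" by (rule K)
    finally have le: "j * ?W + ?W \<le> K" .
    have "recs (\<sigma> (j * ?W + ?W)) \<noteq> recs (\<sigma> (j * ?W))"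
    proof
      assume eq: "recs (\<sigma> (j * ?W + ?W)) = recs (\<sigma> (j * ?W))"
      have "?W < ?W"
      proof (rule transient_stretch_bound[where \<sigma> = "\<lambda>k. \<sigma> (j * ?W + k)" and st = "\<lambda>k. st (j * ?W + k)", OF _ _ _ _ N])
        fix k assume k: "k \<le> ?W"
        show "recs (\<sigma> (j * ?W + k)) = recs (\<sigma> (j * ?W + 0))"
          using anti[of "j * ?W" "j * ?W + k"] anti[of "j * ?W + k" "j * ?W + ?W"] eq k le by auto
      qed (use le sw trans pol in auto)
      then show False by simp
    qed
    then have "recs (\<sigma> (j * ?W + ?W)) \<subset> recs (\<sigma> (j * ?W))"
      using anti[of "j * ?W" "j * ?W + ?W"] le by auto
    then have "card (recs (\<sigma> (j * ?W + ?W))) < card (recs (\<sigma> (j * ?W)))"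
      using fin le by (intro psubset_card_mono) auto
    then show ?case using Suc by (simp add: add.commute)
  qed
  from this[of "n + 1"] show False by simp
qed

section \<open>Arbitrary runs\<close>

text \<open>Gaps are measured against a dominating policy \<open>e\<close>. Any \<open>?B\<close>
  consecutive steps contain a recurrent switch, which contracts the gap; \<open>N2\<close> such
  blocks eliminate a tagged pair. The factor 2 counts the tags.\<close>

lemma run_bound:
  assumes sw: "\<And>k. k < K \<Longrightarrow> switches (\<sigma> k) (st k) (\<sigma> (Suc k))"
    and \<sigma>0: "\<sigma> 0 \<in> policies M"
    and N1: "(real n ^ 2 * T) * (real n ^ 2 * T) \<le> real N1"
    and N2: "(real n * R) * (real n ^ 2 * (T + R)) \<le> real N2"
  shows "K < 2 * card (actions M) * (N2 * ((n + 1) * (card (actions M) * N1)))"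
proof -
  \<comment> \<open>\<open>?d\<close> dominates both \<open>n ^ 2 * T\<close>, used for transient
    states, and \<open>n ^ 2 * R\<close>, used for recurrent ones.\<close>
  let ?B = "(n + 1) * (card (actions M) * N1)" and ?c = "real n * R" and ?d = "real n ^ 2 * (T + R)"
  have n1: "1 \<le> real n" using n_pos by simp
  have c1: "1 \<le> ?c" using mult_mono[of 1 "real n" 1 R] n1 R by simp
  have d1: "0 < ?d" using n1 T R by simp
  obtain e where e: "e \<in> policies M"
    and e_adv: "\<And>i a. \<lbrakk>i < n; a \<in> admissible M i\<rbrakk> \<Longrightarrow> adv e i a \<le> 0"
    using ex_dominating_policy by blast
  have pol: "\<sigma> k \<in> policies M" if "k \<le> K" for k
    using run_policies[OF sw \<sigma>0 that] .
  have Ve: "V \<pi> i \<le> V e i" if "\<pi> \<in> policies M" "i < n" for \<pi> i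
    using V_antimono[OF e that(1) _ that(2)] e_adv policy_admissible[OF that(1)] by blast
  define D where "D k = total e - total (\<sigma> k)" for k
  have D_nonneg: "0 \<le> D k" if "k \<le> K" for k
    using Ve[OF pol[OF that]] by (auto simp: D_def total_def intro!: sum_mono)
  have D_pos: "0 < D k" if "k < K" for k
    using total_less[OF sw[OF that]] D_nonneg[of "Suc k"] that by (simp add: D_def)
  have D_anti: "D l \<le> D k" if "k \<le> l" "l \<le> K" for k l
    using run_total_mono[OF sw \<sigma>0 that] by (simp add: D_def)
  \<comment> \<open>The occupancies of \<open>e\<close> sum to \<open>n / (1 - \<gamma>)\<close>,
    and that of the switched state is at least \<open>1 / ((1 - \<gamma>) * R)\<close>; in the
    quotient \<open>\<gamma>\<close> cancels.\<close>
  have contract: "D (Suc k) \<le> (1 - 1 / ?c) * D k" if "k < K" "st k \<in> recs (\<sigma> (Suc k))" for k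
  proof -
    have \<sigma>k: "\<sigma> k \<in> policies M" "\<sigma> (Suc k) \<in> policies M" using pol that by simp_all
    let ?\<Delta> = "adv (\<sigma> k) (st k) (\<sigma> (Suc k) (st k))" and ?x = "occs (\<sigma> (Suc k)) (st k)"
    have \<Delta>: "0 < ?\<Delta>" "adv (\<sigma> k) i (e i) \<le> ?\<Delta>" if "i < n" for i
      using sw[OF \<open>k < K\<close>] policy_admissible[OF e] that by (auto simp: switches_def)
    have "D k = (\<Sum>i<n. occs e i * adv (\<sigma> k) i (e i))"
      unfolding D_def by (rule total_difference[OF \<sigma>k(1) e])
    also have "\<dots> \<le> (\<Sum>i<n. occs e i * ?\<Delta>)"
    proof (intro sum_mono mult_left_mono)
      show "0 \<le> occs e i" if "i \<in> {..<n}" for i using occs_ge_1[OF e, of i] that by simp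
    qed (use \<Delta> in auto)
    also have "\<dots> = real n / (1 - \<gamma>) * ?\<Delta>"
      using finite_chain.sum_occ[OF chain[OF e] \<gamma>] by (simp flip: sum_distrib_right)
    also have "\<dots> \<le> real n / (1 - \<gamma>) * ?\<Delta> * ((1 - \<gamma>) * ?x * R)"
      using mult_left_mono[OF occs_R[OF \<sigma>k(2) that(2)], of "real n / (1 - \<gamma>) * ?\<Delta>"] \<Delta>(1)[OF n_pos] \<gamma>
      by simp
    also have "\<dots> = ?c * (?x * ?\<Delta>)" using \<gamma> by (simp add: field_simps)
    also have "?x * ?\<Delta> = D k - D (Suc k)"
      using switches_total[OF sw[OF that(1)]] by (simp add: D_def)
    finally have "D k / ?c \<le> D k - D (Suc k)" using c1 by (simp add: pos_divide_le_eq mult.commute)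
    then show ?thesis by (simp add: left_diff_distrib)
  qed
  have window: "D (k + ?B) \<le> (1 - 1 / ?c) * D k" if k: "k + ?B \<le> K" for k
  proof -
    have "\<exists>l<?B. st (k + l) \<in> recs (\<sigma> (Suc (k + l)))"
    proof (rule ccontr)
      assume none: "\<not> ?thesis"
      have "?B < ?B"
      proof (rule transient_run_bound[where \<sigma> = "\<lambda>l. \<sigma> (k + l)" and st = "\<lambda>l. st (k + l)", OF _ _ _ N1])
        show "switches (\<sigma> (k + l)) (st (k + l)) (\<sigma> (k + Suc l))" if "l < ?B" for l
          using sw[of "k + l"] that k by simp
        show "st (k + l) \<notin> recs (\<sigma> (k + Suc l))" if "l < ?B" for l
          using none that by simp
        show "\<sigma> (k + 0) \<in> policies M" using pol[of k] k by simp
      qed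
      then show False by simp
    qed
    then obtain l where l: "l < ?B" "st (k + l) \<in> recs (\<sigma> (Suc (k + l)))" by blast
    have "D (k + ?B) \<le> D (Suc (k + l))" using D_anti[of "Suc (k + l)" "k + ?B"] l k by simp
    also have "\<dots> \<le> (1 - 1 / ?c) * D (k + l)" using contract l k by simp
    also have "\<dots> \<le> (1 - 1 / ?c) * D k"
      using D_anti[of k "k + l"] l k c1 by (intro mult_left_mono) auto
    finally show ?thesis .
  qed
  have gap: "D l * ?d < D k" if "k + N2 * ?B \<le> l" "l \<le> K" "k < K" for k l
  proof -
    have "D l \<le> D (k + N2 * ?B)" using D_anti[OF that(1,2)] .
    also have "\<dots> \<le> (1 - 1 / ?c) ^ N2 * D k"
    proof (rule contraction_steps[where B = ?B and K = K])
      show "D (j + ?B) \<le> (1 - 1 / ?c) * D j" if "j + ?B \<le> K" for j using window[OF that] .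
    qed (use c1 that in auto)
    finally have "D l * ?d \<le> ((1 - 1 / ?c) ^ N2 * ?d) * D k"
      using d1 mult_right_mono[of "D l" "(1 - 1 / ?c) ^ N2 * D k" ?d] by (simp add: mult_ac)
    also have "\<dots> < 1 * D k"
      using contraction_power[OF c1 _ N2] d1 D_pos[OF that(3)] by (intro mult_strict_right_mono) auto
    finally show ?thesis by simp
  qed
  (* The tag True records a pair used at a recurrent state: at such states only that tagged copy is
     eliminated, so the pair may reappear while its state is transient. *)
  define act where "act k = (\<lambda>i. ((i, \<sigma> k i), False)) ` {..<n} \<union> (\<lambda>i. ((i, \<sigma> k i), True)) ` recs (\<sigma> k)" for k
  have act_iff: "((i, a), f) \<in> act k \<longleftrightarrow> a = \<sigma> k i \<and> (if f then i \<in> recs (\<sigma> k) else i < n)" for i a f k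
    by (auto simp: act_def)
  have "K < card (pairs \<times> (UNIV :: bool set)) * (N2 * ?B)"
  proof (rule elimination_bound[where act = act])
    show "finite (pairs \<times> (UNIV :: bool set))" using finite_pairs by simp
    have "card pairs \<noteq> 0"
      using finite_pairs n_pos policy_admissible[OF \<sigma>0 n_pos] by (auto simp: pairs_def)
    moreover have "0 < N1" "0 < N2"
    proof -
      have "0 < (real n ^ 2 * T) * (real n ^ 2 * T)" using n1 T by simp
      then show "0 < N1" using N1 by linarith
      have "0 < ?c * ?d" using c1 d1 by simp
      then show "0 < N2" using N2 by linarith
    qed
    ultimately show B_pos: "0 < N2 * ?B" using card_pairs by simp
    fix k assume k: "k \<le> K"
    note \<sigma>k = pol[OF k]
    have in_pairs: "((i, \<sigma> k i), f) \<in> pairs \<times> UNIV" if "i < n" for i and f :: bool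
      using policy_admissible[OF \<sigma>k that] that by (simp add: pairs_def)
    show "\<exists>u\<in>pairs \<times> UNIV. u \<in> act k \<and> (\<forall>l. k + N2 * ?B \<le> l \<and> l \<le> K \<longrightarrow> u \<notin> act l)"
    proof (cases "k = K")
      case True
      \<comment> \<open>At the end of the run no later time remains, so any pair in use will
        do.\<close>
      then have "\<not> (k + N2 * ?B \<le> l \<and> l \<le> K)" for l using B_pos by linarith
      moreover have "((0, \<sigma> k 0), False) \<in> act k" using n_pos by (simp add: act_iff)
      ultimately have "((0, \<sigma> k 0), False) \<in> act k \<and> (\<forall>l. k + N2 * ?B \<le> l \<and> l \<le> K \<longrightarrow> ((0, \<sigma> k 0), False) \<notin> act l)"
        by blast
      then show ?thesis using in_pairs[OF n_pos] by blast
    next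
      case False
      then have "k < K" using k by simp
      let ?g = "\<lambda>i. - adv e i (\<sigma> k i)"
      have g: "0 \<le> ?g i" if "i < n" for i using e_adv[OF that policy_admissible[OF \<sigma>k that]] by simp
      \<comment> \<open>Some state contributes at least the average \<open>D k / n\<close> to the
        gap; dividing by the occupancy bound \<open>n * T\<close> or
        \<open>n / (1 - \<gamma>)\<close> bounds its loss from below.\<close>
      have "\<exists>i<n. (i \<notin> recs (\<sigma> k) \<and> D k \<le> real n ^ 2 * T * ?g i) \<or>
          (i \<in> recs (\<sigma> k) \<and> D k * (1 - \<gamma>) \<le> real n ^ 2 * ?g i)"
      proof (rule ccontr)
        assume none: "\<not> ?thesis"
        have lt: "occs (\<sigma> k) i * ?g i < D k / real n" if i: "i < n" for i
        proof (cases "i \<in> recs (\<sigma> k)")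
          case True
          have "occs (\<sigma> k) i * ?g i \<le> real n / (1 - \<gamma>) * ?g i"
            using occs_le[OF \<sigma>k i] g[OF i] by (rule mult_right_mono)
          also have "\<dots> < D k / real n"
          proof -
            have "real n ^ 2 * ?g i < D k * (1 - \<gamma>)" using none True i by (meson not_less)
            then show ?thesis using n1 \<gamma> by (simp add: field_simps power2_eq_square)
          qed
          finally show ?thesis .
        next
          case False
          have "occs (\<sigma> k) i * ?g i \<le> real n * T * ?g i"
            using occs_T[OF \<sigma>k i False] g[OF i] by (rule mult_right_mono)
          also have "\<dots> < D k / real n"
          proof -
            have "real n ^ 2 * T * ?g i < D k" using none False i by (meson not_less)
            then show ?thesis using n1 by (simp add: field_simps power2_eq_square)
          qed
          finally show ?thesis .
        qed
        have "D k = - (total (\<sigma> k) - total e)" by (simp add: D_def)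
        also have "\<dots> = (\<Sum>i<n. occs (\<sigma> k) i * ?g i)"
          unfolding total_difference[OF e \<sigma>k] by (simp add: sum_negf)
        also have "\<dots> < (\<Sum>i<n. D k / real n)" using lt n_pos by (intro sum_strict_mono) auto
        finally show False using n_pos by simp
      qed
      then obtain i where i: "i < n" and
        cases: "i \<notin> recs (\<sigma> k) \<and> D k \<le> real n ^ 2 * T * ?g i \<or>
          i \<in> recs (\<sigma> k) \<and> D k * (1 - \<gamma>) \<le> real n ^ 2 * ?g i" by blast
      from cases show ?thesis
      proof (elim disjE conjE)
        assume le: "D k \<le> real n ^ 2 * T * ?g i"
        \<comment> \<open>Here the loss alone exceeds the remaining gap, so the action is excluded
          whether or not its state is recurrent later.\<close>
        have "\<sigma> l i \<noteq> \<sigma> k i" if l: "k + N2 * ?B \<le> l" "l \<le> K" for l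
        proof
          assume same: "\<sigma> l i = \<sigma> k i"
          have "?g i \<le> D l"
            using total_gap_ge[OF e pol[OF l(2)] i Ve[OF pol[OF l(2)]]] same by (simp add: D_def)
          then have "real n ^ 2 * T * ?g i \<le> real n ^ 2 * T * D l" using T by (intro mult_left_mono) auto
          also have "\<dots> \<le> D l * ?d"
            using D_nonneg[OF l(2)] R by (simp add: algebra_simps)
          finally show False using gap[OF l \<open>k < K\<close>] le by linarith
        qed
        then have "((i, \<sigma> k i), False) \<in> act k \<and> (\<forall>l. k + N2 * ?B \<le> l \<and> l \<le> K \<longrightarrow> ((i, \<sigma> k i), False) \<notin> act l)"
          using i by (simp add: act_iff del: add_mult_distrib) metis
        then show ?thesis using in_pairs[OF i] by blast
      next
        assume rec: "i \<in> recs (\<sigma> k)" and le: "D k * (1 - \<gamma>) \<le> real n ^ 2 * ?g i"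
        \<comment> \<open>At a recurrent state the gap is at least loss times occupancy, and the
          occupancy makes up for the factor \<open>1 - \<gamma>\<close> in the bound on the
          loss.\<close>
        have "\<not> (\<sigma> k i = \<sigma> l i \<and> i \<in> recs (\<sigma> l))" if l: "k + N2 * ?B \<le> l" "l \<le> K" for l
        proof
          assume same: "\<sigma> k i = \<sigma> l i \<and> i \<in> recs (\<sigma> l)"
          note \<sigma>l = pol[OF l(2)]
          let ?x = "occs (\<sigma> l) i"
          have x: "1 \<le> ?x" "1 \<le> (1 - \<gamma>) * ?x * R" using occs_ge_1[OF \<sigma>l i] occs_R[OF \<sigma>l] same by auto
          have "?x * ?g i \<le> (\<Sum>j<n. occs (\<sigma> l) j * (- adv e j (\<sigma> l j)))"
          proof -
            have "0 \<le> occs (\<sigma> l) j * (- adv e j (\<sigma> l j))" if "j < n" for j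
              using occs_ge_1[OF \<sigma>l that] e_adv[OF that policy_admissible[OF \<sigma>l that]]
              by (intro mult_nonneg_nonneg) auto
            then show ?thesis
              using same i member_le_sum[of i "{..<n}" "\<lambda>j. occs (\<sigma> l) j * (- adv e j (\<sigma> l j))"] by auto
          qed
          also have "\<dots> = - (total (\<sigma> l) - total e)"
            unfolding total_difference[OF e \<sigma>l] by (simp add: sum_negf)
          finally have gl: "?x * ?g i \<le> D l" by (simp add: D_def)
          have "D k * 1 \<le> D k * ((1 - \<gamma>) * ?x * R)"
            using x D_pos[OF \<open>k < K\<close>] by (intro mult_left_mono) auto
          also have "\<dots> = (D k * (1 - \<gamma>)) * (?x * R)" by simp
          also have "\<dots> \<le> (real n ^ 2 * ?g i) * (?x * R)"
            using le x R by (intro mult_right_mono) auto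
          also have "\<dots> = (real n ^ 2 * R) * (?x * ?g i)" by simp
          also have "\<dots> \<le> (real n ^ 2 * R) * D l"
            using gl R by (intro mult_left_mono) auto
          also have "\<dots> \<le> D l * ?d"
            using D_nonneg[OF l(2)] T by (simp add: algebra_simps)
          finally show False using gap[OF l \<open>k < K\<close>] by linarith
        qed
        then have "((i, \<sigma> k i), True) \<in> act k \<and> (\<forall>l. k + N2 * ?B \<le> l \<and> l \<le> K \<longrightarrow> ((i, \<sigma> k i), True) \<notin> act l)"
          using rec by (auto simp: act_iff)
        then show ?thesis using in_pairs[OF i] by blast
      qed
    qed
  qed
  moreover have "card (pairs \<times> (UNIV :: bool set)) = 2 * card (actions M)"
    by (simp add: card_cartesian_product card_pairs)
  ultimately show ?thesis by (simp only:)
qed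

text \<open>Without an optimal policy up to time \<open>?K\<close> the run consists of
  \<open>?K\<close> genuine switches, and \<open>run_bound\<close> yields
  \<open>?K < ?K\<close>.\<close>

lemma simplex_pi_terminates:
  assumes run: "simplex_pi_run M \<pi>s"
    and N1: "(real n ^ 2 * T) * (real n ^ 2 * T) \<le> real N1"
    and N2: "(real n * R) * (real n ^ 2 * (T + R)) \<le> real N2"
  shows "\<exists>k \<le> 2 * card (actions M) * (N2 * ((n + 1) * (card (actions M) * N1))). optimal M (\<pi>s k)"
proof (rule ccontr)
  let ?K = "2 * card (actions M) * (N2 * ((n + 1) * (card (actions M) * N1)))"
  assume none: "\<not> (\<exists>k \<le> ?K. optimal M (\<pi>s k))"
  have "\<pi>s k \<in> policies M \<and> (k < ?K \<longrightarrow> (\<exists>i. switches (\<pi>s k) i (\<pi>s (Suc k))))" if "k \<le> ?K" for k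
    using that
  proof (induction k)
    case 0
    then show ?case
      using run none simplex_pi_step_switches[of "\<pi>s 0" "\<pi>s 1"] unfolding simplex_pi_run_def
      by (metis One_nat_def le_zero_eq)
  next
    case (Suc k)
    then have pol: "\<pi>s (Suc k) \<in> policies M" by (auto simp: switches_def)
    have "simplex_pi_step M (\<pi>s (Suc k)) (\<pi>s (Suc (Suc k)))"
      using run none Suc.prems unfolding simplex_pi_run_def by (meson le_trans)
    then show ?case using simplex_pi_step_switches[OF _ pol] none Suc.prems pol by metis
  qed
  then obtain st where "\<And>k. k < ?K \<Longrightarrow> switches (\<pi>s k) (st k) (\<pi>s (Suc k))"
    by (metis less_imp_le)
  moreover have "\<pi>s 0 \<in> policies M" using run by (simp add: simplex_pi_run_def)
  ultimately have "?K < ?K" by (rule run_bound[OF _ _ N1 N2])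
  then show False by blast
qed

end

section \<open>The explicit polynomial bound\<close>

lemma simplex_pi_polynomial_bound:
  fixes M :: "'a mdp"
  assumes M: "finite_mdp M" and run: "simplex_pi_run M \<pi>s"
    and T: "1 \<le> T" "tau_t M \<le> T" and R: "1 \<le> R" "tau_r M \<le> R"
  shows "\<exists>k. optimal M (\<pi>s k) \<and> real k \<le>
    2 * real (card (actions M)) * ((real (nstates M) ^ 3 * R * (T + R) + 1) *
      ((real (nstates M) + 1) * (real (card (actions M)) * (real (nstates M) ^ 4 * T ^ 2 + 1))))"
proof -
  interpret fin_mdp M by unfold_locales (rule M)
  interpret bounded_mdp M T R
  proof
    show "occs \<pi> i \<le> real n * T" if "\<pi> \<in> policies M" "i < n" "i \<notin> recs \<pi>" for \<pi> i
      using occs_transient_bound[OF that] T(2) mult_left_mono[of "tau_t M" T "real n"] by simp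
    show "1 \<le> (1 - \<gamma>) * occs \<pi> i * R" if "\<pi> \<in> policies M" "i \<in> recs \<pi>" for \<pi> i
    proof -
      have "i < n" using finite_chain.rec_less[OF chain] that by blast
      then have "(1 - \<gamma>) * occs \<pi> i * tau_r M \<le> (1 - \<gamma>) * occs \<pi> i * R"
        using occs_ge_1[OF that(1), of i] \<gamma> R(2) by (intro mult_left_mono mult_nonneg_nonneg) auto
      then show ?thesis using occs_recurrent_bound[OF that] by linarith
    qed
  qed (use T R in auto)
  \<comment> \<open>Rounding up costs at most 1, whence the two summands 1 next to the powers of
    \<open>n\<close> in the bound.\<close>
  have ex: "\<exists>N. x \<le> real N \<and> real N \<le> x + 1" if "0 \<le> x" for x
    using that by (intro exI[of _ "nat \<lceil>x\<rceil>"]) linarith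
  obtain N1 where N1: "real n ^ 4 * T ^ 2 \<le> real N1" "real N1 \<le> real n ^ 4 * T ^ 2 + 1"
    using ex[of "real n ^ 4 * T ^ 2"] by auto
  obtain N2 where N2: "real n ^ 3 * R * (T + R) \<le> real N2" "real N2 \<le> real n ^ 3 * R * (T + R) + 1"
    using ex[of "real n ^ 3 * R * (T + R)"] T(1) R(1) by auto
  obtain k where k: "k \<le> 2 * card (actions M) * (N2 * ((n + 1) * (card (actions M) * N1)))" "optimal M (\<pi>s k)"
    using simplex_pi_terminates[OF run, of N1 N2] N1(1) N2(1)
    by (auto simp: algebra_simps power2_eq_square eval_nat_numeral)
  have "real k \<le> 2 * real (card (actions M)) * (real N2 * ((real n + 1) * (real (card (actions M)) * real N1)))"
    using k(1) by (metis (mono_tags, opaque_lifting) of_nat_1 of_nat_add of_nat_le_iff of_nat_mult of_nat_numeral)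
  also have "\<dots> \<le> 2 * real (card (actions M)) * ((real n ^ 3 * R * (T + R) + 1) *
      ((real n + 1) * (real (card (actions M)) * (real n ^ 4 * T ^ 2 + 1))))"
    using N1 N2 T(1) R(1) by (intro mult_mono mult_nonneg_nonneg add_nonneg_nonneg) auto
  finally show ?thesis using k(2) by blast
qed

theorem corollary2:
  fixes F :: "nat \<Rightarrow> nat \<Rightarrow> 'a mdp set"
  assumes "\<And>n m M. M \<in> F n m \<Longrightarrow> finite_mdp M \<and> nstates M = n \<and> card (actions M) = m"
    and "\<exists>p. \<forall>n m. \<forall>M\<in>F n m. tau_t M \<le> poly2 p (real n) (real m)"
    and "\<exists>p. \<forall>n m. \<forall>M\<in>F n m. tau_r M \<le> poly2 p (real n) (real m)"
  shows "\<exists>q. \<forall>n m. \<forall>M\<in>F n m. \<forall>\<pi>s. simplex_pi_run M \<pi>s \<longrightarrow>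
           (\<exists>k. optimal M (\<pi>s k) \<and> real k \<le> poly2 q (real n) (real m))"
proof -
  obtain p1 where p1: "\<And>n m M. M \<in> F n m \<Longrightarrow> tau_t M \<le> poly2 p1 (real n) (real m)"
    using assms(2) by blast
  obtain p2 where p2: "\<And>n m M. M \<in> F n m \<Longrightarrow> tau_r M \<le> poly2 p2 (real n) (real m)"
    using assms(3) by blast
  define X Y :: "real poly poly" where "X = [:[:0, 1:]:]" and "Y = [:0, 1:]"
  have [simp]: "poly2 X x y = x" "poly2 Y x y = y" for x y by (simp_all add: X_def Y_def)
  \<comment> \<open>One plus the square is still a polynomial, dominates the given bound and is at
    least 1 whatever values \<open>p1\<close> and \<open>p2\<close> take.\<close>
  define T R where "T = 1 + p1 ^ 2" and "R = 1 + p2 ^ 2"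
  have square: "c \<le> 1 + c\<^sup>2" for c :: real
    using zero_le_power2[of "c - 1 / 2"] by (simp add: power2_eq_square algebra_simps)
  let ?q = "2 * Y * ((X ^ 3 * R * (T + R) + 1) * ((X + 1) * (Y * (X ^ 4 * T ^ 2 + 1))))"
  show ?thesis
  proof (intro exI[of _ ?q] allI ballI impI)
    fix n m M \<pi>s
    assume M: "M \<in> F n m" and run: "simplex_pi_run M \<pi>s"
    have "finite_mdp M" "nstates M = n" "card (actions M) = m" using assms(1)[OF M] by auto
    moreover have "tau_t M \<le> poly2 T (real n) (real m)" "tau_r M \<le> poly2 R (real n) (real m)"
      using order_trans[OF p1[OF M] square] order_trans[OF p2[OF M] square] by (simp_all add: T_def R_def)
    moreover have "1 \<le> poly2 T (real n) (real m)" "1 \<le> poly2 R (real n) (real m)"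
      by (simp_all add: T_def R_def)
    ultimately show "\<exists>k. optimal M (\<pi>s k) \<and> real k \<le> poly2 ?q (real n) (real m)"
      using simplex_pi_polynomial_bound[OF _ run, of "poly2 T (real n) (real m)" "poly2 R (real n) (real m)"]
      by simp
  qed
qed

end
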